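(* Let $k\ge1$, $\varepsilon>0$ and $p\in[\varepsilon,1-\varepsilon]$. If $\inf_{n\ge1}f_p(n,2n)>0$, then $\inf_{n\ge1}f_p(2n,n)>0$.
   Context: $\mathbb S_k=\mathbb Z^2\times\{0,\dots,k\}$ with nearest-neighbour edges; $\mathbf P_p$ Bernoulli bond percolation with parameter $p$. For $T\subset\mathbb Z^2$, $\overline T=T\times\{0,\dots,k\}$. $f_p(m,n)$ is the probability that there is an open path inside $\overline{[0,m]\times[0,n]}$ from $\overline{\{0\}\times[0,n]}$ to $\overline{\{m\}\times[0,n]}$. *)

theory Defs
  imports "HOL-Probability.Probability"
begin

text \<open>Vertices of the slab S_k = Z^2 x {0..k} are integer triples (x,y,z) with 0 \<le> z \<le> k.
  Edges are unordered pairs {u,v} of nearest neighbours (l1-distance 1).\<close>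

type_synonym vertex = "int \<times> int \<times> int"
type_synonym edge = "vertex set"

definition slab :: "nat \<Rightarrow> vertex set" where
  "slab k = {(x,y,z). 0 \<le> z \<and> z \<le> int k}"

definition nn :: "vertex \<Rightarrow> vertex \<Rightarrow> bool" where
  "nn u v = (case u of (x1,y1,z1) \<Rightarrow> case v of (x2,y2,z2) \<Rightarrow>
              \<bar>x1 - x2\<bar> + \<bar>y1 - y2\<bar> + \<bar>z1 - z2\<bar> = 1)"

text \<open>Edges of the graph induced on a vertex set V.\<close>
definition edges_on :: "vertex set \<Rightarrow> edge set" where
  "edges_on V = {{u,v} | u v. u \<in> V \<and> v \<in> V \<and> nn u v}"

text \<open>Bernoulli bond percolation P_p on S_k: product of Bernoulli(p) over all edges.\<close>
definition perc :: "nat \<Rightarrow> real \<Rightarrow> (edge \<Rightarrow> bool) measure" where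
  "perc k p = PiM (edges_on (slab k)) (\<lambda>_. measure_pmf (bernoulli_pmf p))"

text \<open>The thickened rectangle  overline{[0,m] x [0,n]}.\<close>
definition box :: "nat \<Rightarrow> int \<Rightarrow> int \<Rightarrow> int \<Rightarrow> int \<Rightarrow> vertex set" where
  "box k a b c d = {(x,y,z). a \<le> x \<and> x \<le> b \<and> c \<le> y \<and> y \<le> d \<and> 0 \<le> z \<and> z \<le> int k}"

text \<open>Open path inside box V from A to B in configuration \<omega>:
  reachability via open edges whose endpoints lie in V.\<close>
definition open_conn :: "(edge \<Rightarrow> bool) \<Rightarrow> vertex set \<Rightarrow> vertex \<Rightarrow> vertex \<Rightarrow> bool" where
  "open_conn \<omega> V u v =
     ((u, v) \<in> ({(a,b). a \<in> V \<and> b \<in> V \<and> nn a b \<and> \<omega> {a,b}})\<^sup>*)"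

definition crossing_event :: "nat \<Rightarrow> nat \<Rightarrow> nat \<Rightarrow> (edge \<Rightarrow> bool) set" where
  "crossing_event k m n =
     {\<omega>. \<exists>u v. u \<in> box k 0 0 0 (int n) \<and> v \<in> box k (int m) (int m) 0 (int n) \<and>
            open_conn \<omega> (box k 0 (int m) 0 (int n)) u v}"

definition f :: "nat \<Rightarrow> real \<Rightarrow> nat \<Rightarrow> nat \<Rightarrow> real" where
  "f k p m n = measure (perc k p) (crossing_event k m n \<inter> space (perc k p))"

end

theory Submission
  imports Defs
begin

text \<open>
  Gluing: let \<open>\<gamma>\<close> and \<open>\<delta>\<close> be the lexicographically minimal open paths of two crossings that are forced
  to meet in projection. If they use a common column without being connected, then joining one of them
  vertically to the cluster of the other changes a bounded number of edges, and the place of the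
  change can be recovered because the minimal path does not change. So projected paths can be
  glued at the cost of a constant factor.

  From the hypothesis one gets crossings of near-squares in the easy direction. In the right
  half of a near-square explore everything connected to the right side \<open>J\<close>, and let \<open>\<delta>\<close> be
  the minimal path from \<open>J\<close> to the middle line. A path from a bottom segment \<open>I\<close> to the top either comes
  close to the explored set, which yields a connection from \<open>I\<close> to \<open>J\<close>, or it hits the mirror image of \<open>\<delta>\<close>
  using unexplored edges only. In the second case, gluing with the mirrored event yields a
  connection from \<open>I\<close> to its mirror image; in the first case, gluing with a vertical crossing from another bottom
  segment yields a connection between two bottom segments. In both cases there is an arch between two separated
  short bottom segments, and arches that interlace with their own translates are glued to a long crossing.
\<close>

section \<open>Product measure on finite edge sets\<close>

text \<open>In the plane two crossing paths share a vertex. In a slab one may pass above the other,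
  so planar arguments only yield paths that meet in projection. Every gluing costs a factor that
  depends on \<open>p\<close> and \<open>k\<close> only, and the number of gluings is the same at
  all scales.

  Conditioning on the exploration destroys the reflection symmetry, because explored edges lie on
  one side only. The second case is therefore bounded by an increasing event in a symmetric region,
  under the unconditioned measure, where reflection is available again.

  All lengths are multiples of a scale \<open>d\<close>. Both the half box of width
  \<open>54 * d\<close>, crossed from side to side, and a box of width \<open>96 * d\<close>,
  crossed from bottom to top, have height \<open>72 * d\<close>; they are enlarged copies (by 9 and
  by 12) of one near-square, of length 6 in the direction of crossing and 8 across. The wider box
  has half width \<open>48 * d\<close>, so within half width \<open>54 * d\<close> there remains
  \<open>6 * d\<close> for moving bottom segments.\<close>

locale bernoulli =
  fixes p :: real
  assumes p_pos: "0 < p" and p_less_1: "p < 1"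
begin

text \<open>A configuration is the set \<open>S\<close> of open edges of a finite edge set
  \<open>E\<close>. Expectations are then finite sums, open to induction on \<open>E\<close>;
  \<open>f_eq_X\<close> makes the connection with the infinite product measure.\<close>

definition wt :: "'e set \<Rightarrow> 'e set \<Rightarrow> real" where
  "wt E S = (\<Prod>e\<in>E. if e \<in> S then p else 1 - p)"

definition ex :: "'e set \<Rightarrow> ('e set \<Rightarrow> real) \<Rightarrow> real" where
  "ex E h = (\<Sum>S\<in>Pow E. wt E S * h S)"

definition pr :: "'e set \<Rightarrow> ('e set \<Rightarrow> bool) \<Rightarrow> real" where
  "pr E A = ex E (\<lambda>S. of_bool (A S))"

lemma wt_pos: "0 < wt E S"
  unfolding wt_def using p_pos p_less_1 by (intro prod_pos) auto

lemma ex_cong: "(\<And>S. S \<subseteq> E \<Longrightarrow> g S = h S) \<Longrightarrow> ex E g = ex E h"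
  unfolding ex_def by (intro sum.cong) auto

lemma ex_mono: "(\<And>S. S \<subseteq> E \<Longrightarrow> g S \<le> h S) \<Longrightarrow> ex E g \<le> ex E h"
  unfolding ex_def by (intro sum_mono mult_left_mono) (auto intro: less_imp_le wt_pos)

lemma ex_add: "ex E (\<lambda>S. g S + h S) = ex E g + ex E h"
  unfolding ex_def by (simp add: algebra_simps sum.distrib)

lemma ex_cmult: "ex E (\<lambda>S. c * h S) = c * ex E h"
  unfolding ex_def by (simp add: algebra_simps sum_distrib_left)

lemma ex_multc: "ex E (\<lambda>S. h S * c) = ex E h * c"
  unfolding ex_def by (simp add: algebra_simps sum_distrib_left)

lemma ex_sum: "ex E (\<lambda>S. \<Sum>i\<in>I. h i S) = (\<Sum>i\<in>I. ex E (h i))"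
  unfolding ex_def sum_distrib_left by (rule sum.swap)

lemma ex_empty [simp]: "ex {} h = h {}"
  unfolding ex_def wt_def by simp

lemma ex_insert:
  assumes "finite E" "e \<notin> E"
  shows "ex (insert e E) h = p * ex E (\<lambda>S. h (insert e S)) + (1 - p) * ex E h"
proof -
  have wt1: "wt (insert e E) (insert e S) = p * wt E S" for S
    using assms unfolding wt_def by (simp, intro disjI2 prod.cong) auto
  have wt2: "wt (insert e E) S = (1 - p) * wt E S" if "S \<subseteq> E" for S
    using assms that unfolding wt_def by auto
  have "inj_on (insert e) (Pow E)"
  proof (rule inj_onI)
    fix x y assume "x \<in> Pow E" "y \<in> Pow E" "insert e x = insert e y"
    then show "x = y" using assms(2) insert_ident[of e x y] by blast
  qed
  moreover have "Pow E \<inter> insert e ` Pow E = {}"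
    using assms by auto
  ultimately have "ex (insert e E) h =
      (\<Sum>S\<in>Pow E. wt (insert e E) S * h S) + (\<Sum>S\<in>Pow E. wt (insert e E) (insert e S) * h (insert e S))"
    unfolding ex_def Pow_insert using assms
    by (subst sum.union_disjoint) (auto simp: sum.reindex)
  also have "\<dots> = (1 - p) * ex E h + p * ex E (\<lambda>S. h (insert e S))"
    unfolding ex_def sum_distrib_left wt1
    by (intro arg_cong2[of _ _ _ _ "(+)"] sum.cong) (auto simp: wt2)
  finally show ?thesis by simp
qed

lemma ex_const [simp]: "finite E \<Longrightarrow> ex E (\<lambda>_. c) = c"
  by (induction E rule: finite_induct) (auto simp: ex_insert algebra_simps)

lemma ex_Un:
  assumes "finite E" "finite F" "E \<inter> F = {}"
  shows "ex (E \<union> F) h = ex E (\<lambda>S. ex F (\<lambda>T. h (S \<union> T)))"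
  using assms
proof (induction E arbitrary: h rule: finite_induct)
  case (insert e E)
  then show ?case
    by (simp add: ex_insert)
qed simp

lemma ex_image:
  assumes "finite E" "inj_on \<phi> E"
  shows "ex (\<phi> ` E) h = ex E (\<lambda>S. h (\<phi> ` S))"
  using assms
proof (induction E arbitrary: h rule: finite_induct)
  case (insert e E)
  then show ?case
    by (simp add: ex_insert)
qed simp

lemma ex_marginal:
  assumes "finite E" "F \<subseteq> E" "\<And>S. S \<subseteq> E \<Longrightarrow> h S = h (S \<inter> F)"
  shows "ex E h = ex F h"
proof -
  have fin: "finite F" "finite (E - F)" using assms finite_subset by auto
  have "ex E h = ex F (\<lambda>S. ex (E - F) (\<lambda>T. h (S \<union> T)))"
    using ex_Un[of F "E - F" h] fin assms(2) by (simp add: Un_absorb1)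
  also have "\<dots> = ex F h"
  proof (intro ex_cong)
    fix S assume S: "S \<subseteq> F"
    have "ex (E - F) (\<lambda>T. h (S \<union> T)) = ex (E - F) (\<lambda>T. h S)"
    proof (rule ex_cong)
      fix T assume "T \<subseteq> E - F"
      then have "S \<union> T \<subseteq> E" "(S \<union> T) \<inter> F = S"
        using assms(2) S by auto
      then have "h (S \<union> T) = h ((S \<union> T) \<inter> F)" "(S \<union> T) \<inter> F = S"
        using assms(3) by blast+
      then show "h (S \<union> T) = h S" by simp
    qed
    then show "ex (E - F) (\<lambda>T. h (S \<union> T)) = h S" using fin by simp
  qed
  finally show ?thesis .
qed

text \<open>Harris' inequality. Once the state of the new edge is fixed, both functions are still
  increasing, and their conditional means are ordered alike, \<open>a0 \<le> a1\<close> and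
  \<open>b0 \<le> b1\<close>. The covariance of these means is
  \<open>p * (1 - p) * ((a1 - a0) * (b1 - b0))\<close>, which is nonnegative.\<close>

lemma ex_fkg:
  assumes "finite E" "\<And>S T. S \<subseteq> T \<Longrightarrow> T \<subseteq> E \<Longrightarrow> g S \<le> g T" "\<And>S T. S \<subseteq> T \<Longrightarrow> T \<subseteq> E \<Longrightarrow> h S \<le> h T"
  shows "ex E g * ex E h \<le> ex E (\<lambda>S. g S * h S)"
  using assms
proof (induction E arbitrary: g h rule: finite_induct)
  case (insert e E)
  define a1 where "a1 = ex E (\<lambda>S. g (insert e S))"
  define a0 where "a0 = ex E g"
  define b1 where "b1 = ex E (\<lambda>S. h (insert e S))"
  define b0 where "b0 = ex E h"
  have "a0 \<le> a1" "b0 \<le> b1"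
    unfolding a0_def a1_def b0_def b1_def by (auto intro!: ex_mono insert.prems)
  then have "0 \<le> p * (1 - p) * ((a1 - a0) * (b1 - b0))"
    using p_pos p_less_1 by (intro mult_nonneg_nonneg) auto
  then have "(p * a1 + (1 - p) * a0) * (p * b1 + (1 - p) * b0) \<le> p * (a1 * b1) + (1 - p) * (a0 * b0)"
    by (simp add: algebra_simps)
  also have "\<dots> \<le> p * ex E (\<lambda>S. g (insert e S) * h (insert e S)) + (1 - p) * ex E (\<lambda>S. g S * h S)"
    unfolding a0_def a1_def b0_def b1_def
    using p_pos p_less_1
    by (intro add_mono mult_left_mono insert.IH) (auto intro!: insert.prems)
  finally show ?case
    using insert.hyps by (simp add: ex_insert a0_def a1_def b0_def b1_def)
qed simp

lemma pr_mono: "(\<And>S. S \<subseteq> E \<Longrightarrow> A S \<Longrightarrow> B S) \<Longrightarrow> pr E A \<le> pr E B"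
  unfolding pr_def by (intro ex_mono) auto

lemma pr_cong: "(\<And>S. S \<subseteq> E \<Longrightarrow> A S = B S) \<Longrightarrow> pr E A = pr E B"
  unfolding pr_def by (intro ex_cong) auto

lemma pr_nonneg [simp]: "0 \<le> pr E A"
  unfolding pr_def ex_def by (intro sum_nonneg mult_nonneg_nonneg) (auto intro: less_imp_le wt_pos)

lemma pr_pos: "finite E \<Longrightarrow> S \<subseteq> E \<Longrightarrow> A S \<Longrightarrow> 0 < pr E A"
  unfolding pr_def ex_def
  by (rule sum_pos2[of _ S]) (auto intro: less_imp_le wt_pos)

lemma pr_union:
  assumes "finite I" "\<And>S. S \<subseteq> E \<Longrightarrow> A S \<Longrightarrow> \<exists>i\<in>I. B i S"
  shows "pr E A \<le> (\<Sum>i\<in>I. pr E (B i))"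
proof -
  have "pr E A \<le> ex E (\<lambda>S. \<Sum>i\<in>I. of_bool (B i S))"
    unfolding pr_def
  proof (intro ex_mono)
    fix S assume S: "S \<subseteq> E"
    show "of_bool (A S) \<le> (\<Sum>i\<in>I. of_bool (B i S) :: real)"
    proof (cases "A S")
      case True
      then obtain i where "i \<in> I" "B i S" using assms S by auto
      then show ?thesis
        using member_le_sum[of i I "\<lambda>i. of_bool (B i S) :: real"] assms(1) by auto
    qed (auto intro: sum_nonneg)
  qed
  then show ?thesis by (simp add: ex_sum pr_def)
qed

lemma pr_union2:
  assumes "\<And>S. S \<subseteq> E \<Longrightarrow> A S \<Longrightarrow> B S \<or> C S"
  shows "pr E A \<le> pr E B + pr E C"
  unfolding pr_def ex_add[symmetric] using assms by (intro ex_mono) auto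

lemma pr_marginal:
  assumes "finite E" "F \<subseteq> E" "\<And>S. S \<subseteq> E \<Longrightarrow> A S = A (S \<inter> F)"
  shows "pr E A = pr F A"
  unfolding pr_def using assms by (intro ex_marginal) auto

lemma pr_fkg:
  assumes "finite E" "\<And>S T. S \<subseteq> T \<Longrightarrow> A S \<Longrightarrow> A T" "\<And>S T. S \<subseteq> T \<Longrightarrow> B S \<Longrightarrow> B T"
  shows "pr E A * pr E B \<le> pr E (\<lambda>S. A S \<and> B S)"
proof -
  have "pr E A * pr E B \<le> ex E (\<lambda>S. of_bool (A S) * of_bool (B S))"
    unfolding pr_def using assms by (intro ex_fkg) auto
  then show ?thesis by (simp add: pr_def of_bool_conj)
qed

text \<open>A step of an exploration: \<open>\<kappa> S\<close> is the explored set of edges. Whether it equals \<open>F\<close> is decided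
  by the edges in \<open>F\<close>, so the edges outside are still independent of it.\<close>
lemma pr_explore:
  assumes "finite E" "\<And>S. S \<subseteq> E \<Longrightarrow> \<kappa> S \<subseteq> E"
    and "\<And>S. S \<subseteq> E \<Longrightarrow> \<kappa> (S \<inter> \<kappa> S) = \<kappa> S"
    and "\<And>S. S \<subseteq> E \<Longrightarrow> A S \<Longrightarrow> B (S \<inter> \<kappa> S) (S - \<kappa> S)"
    and "\<And>T F. T \<subseteq> F \<Longrightarrow> F \<subseteq> E \<Longrightarrow> pr (E - F) (B T) \<le> y" and "0 \<le> y"
    and det: "\<And>S F. S \<subseteq> E \<Longrightarrow> F \<subseteq> E \<Longrightarrow> \<kappa> (S \<inter> F) = F \<Longrightarrow> \<kappa> S = F"
  shows "pr E A \<le> y"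
proof -
  \<comment> \<open>Decompose over the possible values \<open>F\<close> of the explored set. For
    fixed \<open>F\<close> the test on \<open>\<kappa>\<close> involves only edges in
    \<open>F\<close>, and once \<open>S \<inter> F\<close> is given, \<open>B\<close> involves only
    the edges outside \<open>F\<close>.\<close>
  have "pr E A \<le> (\<Sum>F\<in>Pow E. pr E (\<lambda>S. \<kappa> (S \<inter> F) = F \<and> B (S \<inter> F) (S - F)))"
  proof (rule pr_union)
    fix S assume S: "S \<subseteq> E" "A S"
    then show "\<exists>F\<in>Pow E. \<kappa> (S \<inter> F) = F \<and> B (S \<inter> F) (S - F)"
      using assms(2-4) by (intro bexI[of _ "\<kappa> S"]) auto
  qed (use assms(1) in simp)
  also have "\<dots> \<le> (\<Sum>F\<in>Pow E. y * pr E (\<lambda>S. \<kappa> (S \<inter> F) = F))"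
  proof (intro sum_mono)
    fix F assume F: "F \<in> Pow E"
    then have fin: "finite F" "finite (E - F)" "F \<union> (E - F) = E"
      using assms(1) finite_subset by auto
    have "pr E (\<lambda>S. \<kappa> (S \<inter> F) = F \<and> B (S \<inter> F) (S - F)) =
      ex F (\<lambda>S. ex (E - F) (\<lambda>T. of_bool (\<kappa> ((S \<union> T) \<inter> F) = F \<and> B ((S \<union> T) \<inter> F) (S \<union> T - F))))"
      unfolding pr_def using ex_Un[of F "E - F"] fin by simp
    also have "\<dots> = ex F (\<lambda>S. of_bool (\<kappa> S = F) * pr (E - F) (B S))"
      unfolding pr_def ex_cmult[symmetric]
    proof (intro ex_cong)
      fix S T assume "S \<subseteq> F" "T \<subseteq> E - F"
      then have "(S \<union> T) \<inter> F = S" "S \<union> T - F = T" by auto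
      then show "of_bool (\<kappa> ((S \<union> T) \<inter> F) = F \<and> B ((S \<union> T) \<inter> F) (S \<union> T - F)) =
        (of_bool (\<kappa> S = F) * of_bool (B S T) :: real)" by simp
    qed
    also have "\<dots> \<le> ex F (\<lambda>S. of_bool (\<kappa> S = F) * y)"
      using assms(5) F by (intro ex_mono mult_left_mono) auto
    also have "\<dots> = y * pr F (\<lambda>S. \<kappa> S = F)"
      by (simp only: ex_multc pr_def mult.commute[of y])
    also have "pr F (\<lambda>S. \<kappa> S = F) = pr F (\<lambda>S. \<kappa> (S \<inter> F) = F)"
      by (intro pr_cong) (simp add: Int_absorb2)
    also have "\<dots> = pr E (\<lambda>S. \<kappa> (S \<inter> F) = F)"
      using F assms(1) by (intro pr_marginal[symmetric]) auto
    finally show "pr E (\<lambda>S. \<kappa> (S \<inter> F) = F \<and> B (S \<inter> F) (S - F)) \<le> y * pr E (\<lambda>S. \<kappa> (S \<inter> F) = F)" .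
  qed
  also have "\<dots> = y * ex E (\<lambda>S. \<Sum>F\<in>Pow E. of_bool (\<kappa> (S \<inter> F) = F))"
    by (simp add: sum_distrib_left ex_sum pr_def)
  also have "\<dots> \<le> y * ex E (\<lambda>S. 1)"
  proof (intro mult_left_mono ex_mono)
    fix S assume S: "S \<subseteq> E"
    \<comment> \<open>By \<open>det\<close> only \<open>F = \<kappa> S\<close> can pass the test, so
      the events for different \<open>F\<close> are disjoint.\<close>
    have "(\<Sum>F\<in>Pow E. of_bool (\<kappa> (S \<inter> F) = F)) \<le> (\<Sum>F\<in>Pow E. if F = \<kappa> S then 1 else 0 :: real)"
    proof (rule sum_mono)
      fix F assume "F \<in> Pow E"
      then show "of_bool (\<kappa> (S \<inter> F) = F) \<le> (if F = \<kappa> S then 1 else 0 :: real)"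
        using det[OF S, of F] by (cases "\<kappa> (S \<inter> F) = F") auto
    qed
    also have "\<dots> \<le> 1" using assms(1) by simp
    finally show "(\<Sum>F\<in>Pow E. of_bool (\<kappa> (S \<inter> F) = F)) \<le> (1 :: real)" .
  qed (rule \<open>0 \<le> y\<close>)
  finally show ?thesis using assms(1) by simp
qed

section \<open>Comparison of probabilities by local modification\<close>

lemma wt_le_wt:
  assumes "finite E" "finite F" "card F \<le> m" "S - F = S' - F"
  shows "wt E S \<le> (1 / min p (1 - p)) ^ m * wt E S'"
proof -
  let ?c = "1 / min p (1 - p)"
  have c: "1 \<le> ?c" using p_pos p_less_1 by (auto simp: min_def field_simps)
  have le: "(if e \<in> S then p else 1 - p) \<le> (if e \<in> F then ?c else 1) * (if e \<in> S' then p else 1 - p)" for e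
  proof (cases "e \<in> F")
    case True
    have "(if e \<in> S then p else 1 - p) \<le> 1" using p_pos p_less_1 by auto
    also have "1 \<le> ?c * (if e \<in> S' then p else 1 - p)"
      using p_pos p_less_1 by (auto simp: min_def field_simps)
    finally show ?thesis using True by auto
  next
    case False
    then have "e \<in> S \<longleftrightarrow> e \<in> S'" using assms(4) by blast
    then show ?thesis using False by auto
  qed
  have "wt E S \<le> (\<Prod>e\<in>E. (if e \<in> F then ?c else 1) * (if e \<in> S' then p else 1 - p))"
    unfolding wt_def using p_pos p_less_1 le by (intro prod_mono) auto
  also have "\<dots> = ?c ^ card (E \<inter> F) * wt E S'"
    unfolding wt_def prod.distrib using assms(1)
    by (simp add: prod.If_cases)
  also have "\<dots> \<le> ?c ^ m * wt E S'"
  proof -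
    have "card (E \<inter> F) \<le> m" using assms card_mono[of F "E \<inter> F"] by auto
    then show ?thesis using c wt_pos[of E S'] by (intro mult_right_mono power_increasing) auto
  qed
  finally show ?thesis .
qed

text \<open>The set of edges where \<open>S\<close> may differ from its image \<open>S'\<close> is a
  function of \<open>S'\<close>. Hence \<open>S\<close> is recovered from \<open>S'\<close> and
  \<open>S \<inter> F S'\<close>, which leaves at most \<open>2 ^ m\<close> preimages, and weights
  change by at most a factor \<open>1 / min p (1 - p)\<close> per altered edge. The constant is the
  product of the two effects.\<close>

lemma pr_surgery:
  assumes "finite E"
    and F: "\<And>S'. finite (F S')" "\<And>S'. card (F S') \<le> m"
    and surg: "\<And>S. S \<subseteq> E \<Longrightarrow> A S \<Longrightarrow> \<exists>S'. S' \<subseteq> E \<and> B S' \<and> S - F S' = S' - F S'"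
  shows "pr E A \<le> (2 / min p (1 - p)) ^ m * pr E B"
proof -
  let ?c = "1 / min p (1 - p)"
  have c: "0 \<le> ?c" using p_pos p_less_1 by auto
  define X where "X = {S. S \<subseteq> E \<and> A S}"
  define Y where "Y = {S. S \<subseteq> E \<and> B S}"
  have fin: "finite X" "finite Y" unfolding X_def Y_def using assms(1) by auto
  obtain \<Phi> where \<Phi>: "\<And>S. S \<in> X \<Longrightarrow> \<Phi> S \<in> Y \<and> S - F (\<Phi> S) = \<Phi> S - F (\<Phi> S)"
    using surg unfolding X_def Y_def by simp metis
  have sumX: "pr E A = (\<Sum>S\<in>X. wt E S)" "pr E B = (\<Sum>S\<in>Y. wt E S)"
    unfolding pr_def ex_def X_def Y_def using assms(1)
    by (auto intro!: sum.mono_neutral_cong_right)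
  have "pr E A \<le> (\<Sum>S\<in>X. ?c ^ m * wt E (\<Phi> S))"
    unfolding sumX
  proof (rule sum_mono)
    fix S assume "S \<in> X"
    then show "wt E S \<le> ?c ^ m * wt E (\<Phi> S)"
      using \<Phi> F assms(1) by (intro wt_le_wt[of E "F (\<Phi> S)"]) auto
  qed
  also have "\<dots> = (\<Sum>S'\<in>Y. \<Sum>S\<in>{S\<in>X. \<Phi> S = S'}. ?c ^ m * wt E (\<Phi> S))"
    using fin \<Phi> by (intro sum.group[symmetric]) auto
  also have "\<dots> = (\<Sum>S'\<in>Y. real (card {S\<in>X. \<Phi> S = S'}) * (?c ^ m * wt E S'))"
    by (intro sum.cong) auto
  also have "\<dots> \<le> (\<Sum>S'\<in>Y. 2 ^ m * (?c ^ m * wt E S'))"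
  proof (intro sum_mono mult_right_mono)
    fix S' assume "S' \<in> Y"
    have "inj_on (\<lambda>S. S \<inter> F S') {S\<in>X. \<Phi> S = S'}"
    proof (intro inj_onI)
      fix S T assume *: "S \<in> {S\<in>X. \<Phi> S = S'}" "T \<in> {S\<in>X. \<Phi> S = S'}" "S \<inter> F S' = T \<inter> F S'"
      then have "S - F S' = T - F S'" using \<Phi>[of S] \<Phi>[of T] by simp
      with *(3) show "S = T" by blast
    qed
    then have "card {S\<in>X. \<Phi> S = S'} \<le> card (Pow (F S'))"
      using F by (intro card_inj_on_le[of "\<lambda>S. S \<inter> F S'"]) auto
    also have "\<dots> \<le> 2 ^ m"
      using F by (simp add: card_Pow power_increasing)
    finally show "real (card {S\<in>X. \<Phi> S = S'}) \<le> 2 ^ m"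
      by (simp add: of_nat_le_iff[symmetric] del: of_nat_le_iff)
  qed (intro mult_nonneg_nonneg zero_le_power c less_imp_le[OF wt_pos])
  also have "\<dots> = (2 / min p (1 - p)) ^ m * pr E B"
    unfolding sumX by (simp add: sum_distrib_left power_divide mult.assoc)
  finally show ?thesis .
qed

end

section \<open>Minimal paths and gluing\<close>

definition stp :: "'v set set \<Rightarrow> 'v set \<Rightarrow> ('v \<times> 'v) set" where
  "stp S W = {(a, b). a \<in> W \<and> b \<in> W \<and> {a, b} \<in> S}"

definition conn :: "'v set set \<Rightarrow> 'v set \<Rightarrow> 'v set \<Rightarrow> 'v set \<Rightarrow> bool" where
  "conn S W A B \<longleftrightarrow> (\<exists>a\<in>A \<inter> W. \<exists>b\<in>B. (a, b) \<in> (stp S W)\<^sup>*)"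

definition walk :: "'v set set \<Rightarrow> 'v set \<Rightarrow> 'v list \<Rightarrow> bool" where
  "walk S W xs \<longleftrightarrow> xs \<noteq> [] \<and> set xs \<subseteq> W \<and> successively (\<lambda>a b. {a, b} \<in> S) xs"

text \<open>Paths are self-avoiding so that there are finitely many of them in a finite region and a
  minimal one exists.\<close>

definition paths :: "'v set set \<Rightarrow> 'v set \<Rightarrow> 'v set \<Rightarrow> 'v set \<Rightarrow> 'v list set" where
  "paths S W A B = {xs. walk S W xs \<and> distinct xs \<and> hd xs \<in> A \<and> last xs \<in> B}"

lemma sym_stp: "sym (stp S W)"
  by (auto simp: sym_def stp_def insert_commute)

lemma stp_rtrancl_sym: "(a, b) \<in> (stp S W)\<^sup>* \<Longrightarrow> (b, a) \<in> (stp S W)\<^sup>*"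
  using sym_rtrancl[OF sym_stp] by (rule symD)

lemma stp_mono: "S \<subseteq> S' \<Longrightarrow> W \<subseteq> W' \<Longrightarrow> stp S W \<subseteq> stp S' W'"
  by (auto simp: stp_def)

lemma stp_rtrancl_mono: "S \<subseteq> S' \<Longrightarrow> W \<subseteq> W' \<Longrightarrow> (a, b) \<in> (stp S W)\<^sup>* \<Longrightarrow> (a, b) \<in> (stp S' W')\<^sup>*"
  using rtrancl_mono[OF stp_mono] by blast

lemma stp_rtrancl_in: "(a, b) \<in> (stp S W)\<^sup>* \<Longrightarrow> a \<in> W \<Longrightarrow> b \<in> W"
  by (induction rule: rtrancl_induct) (auto simp: stp_def)

lemma conn_mono: "S \<subseteq> S' \<Longrightarrow> W \<subseteq> W' \<Longrightarrow> A \<subseteq> A' \<Longrightarrow> B \<subseteq> B' \<Longrightarrow> conn S W A B \<Longrightarrow> conn S' W' A' B'"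
  unfolding conn_def using stp_rtrancl_mono[of S S' W W'] by (meson Int_mono subsetD)

lemma conn_commute: "conn S W A B \<longleftrightarrow> conn S W B A"
proof -
  have "conn S W B A" if conn: "conn S W A B" for A B
  proof -
    obtain a b where "a \<in> A" "a \<in> W" "b \<in> B" "(a, b) \<in> (stp S W)\<^sup>*"
      using conn unfolding conn_def by blast
    then show ?thesis
      using stp_rtrancl_sym[of a b S W] stp_rtrancl_in[of a b S W] unfolding conn_def by blast
  qed
  then show ?thesis by blast
qed

lemma walk_snoc: "walk S W xs \<Longrightarrow> b \<in> W \<Longrightarrow> {last xs, b} \<in> S \<Longrightarrow> walk S W (xs @ [b])"
  by (auto simp: walk_def successively_append_iff)

lemma rtrancl_imp_walk:
  assumes "(a, b) \<in> (stp S W)\<^sup>*" "a \<in> W"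
  shows "\<exists>xs. walk S W xs \<and> hd xs = a \<and> last xs = b"
  using assms
proof (induction rule: rtrancl_induct)
  case base
  then show ?case by (intro exI[of _ "[a]"]) (auto simp: walk_def)
next
  case (step b c)
  then obtain xs where "walk S W xs" "hd xs = a" "last xs = b" by auto
  then show ?case
    using step.hyps by (intro exI[of _ "xs @ [c]"]) (auto simp: walk_snoc stp_def, auto simp: walk_def)
qed

lemma walk_hd_rtrancl: "walk S W xs \<Longrightarrow> b \<in> set xs \<Longrightarrow> (hd xs, b) \<in> (stp S W)\<^sup>*"
proof (induction xs)
  case (Cons a xs)
  show ?case
  proof (cases "b = a")
    case False
    then have b: "b \<in> set xs" "xs \<noteq> []" using Cons.prems by auto
    then have "(a, hd xs) \<in> stp S W" "walk S W xs"
      using Cons.prems by (auto simp: walk_def stp_def successively_Cons)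
    then show ?thesis using Cons.IH b by (auto intro: converse_rtrancl_into_rtrancl)
  qed simp
qed simp

lemma walk_rtrancl: "walk S W xs \<Longrightarrow> a \<in> set xs \<Longrightarrow> b \<in> set xs \<Longrightarrow> (a, b) \<in> (stp S W)\<^sup>*"
  using walk_hd_rtrancl stp_rtrancl_sym by (metis rtrancl_trans)

lemma walk_cn: "walk S W xs \<Longrightarrow> a \<in> set xs \<Longrightarrow> a \<in> A \<Longrightarrow> b \<in> set xs \<Longrightarrow> b \<in> B \<Longrightarrow> conn S W A B"
  unfolding conn_def using walk_rtrancl[of S W xs a b] by (auto simp: walk_def)

lemma successively_glue:
  "successively P (a @ [x]) \<Longrightarrow> successively P (x # b) \<Longrightarrow> successively P (a @ x # b)"
  by (auto simp: successively_append_iff)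

lemma walk_imp_distinct:
  "walk S W xs \<Longrightarrow> \<exists>ys. walk S W ys \<and> distinct ys \<and> hd ys = hd xs \<and> last ys = last xs \<and> set ys \<subseteq> set xs"
proof (induction "length xs" arbitrary: xs rule: less_induct)
  case less
  show ?case
  proof (cases "distinct xs")
    case False
    then obtain as y bs cs where xs: "xs = as @ [y] @ bs @ [y] @ cs"
      using not_distinct_decomp by blast
    define zs where "zs = as @ y # cs"
    have "walk S W zs"
      using less.prems unfolding walk_def xs zs_def
      by (auto intro!: successively_glue simp: successively_append_iff successively_Cons)
    moreover have "length zs < length xs" "hd zs = hd xs" "last zs = last xs" "set zs \<subseteq> set xs"
      unfolding xs zs_def by (auto simp: hd_append)
    ultimately show ?thesis using less.hyps[of zs] by (metis order_trans)
  qed (use less.prems in auto)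
qed

lemma conn_iff_paths: "conn S W A B \<longleftrightarrow> paths S W A B \<noteq> {}"
proof
  assume "conn S W A B"
  then obtain a b where "a \<in> A" "a \<in> W" "b \<in> B" "(a, b) \<in> (stp S W)\<^sup>*" by (auto simp: conn_def)
  then obtain xs where "walk S W xs" "hd xs \<in> A" "last xs \<in> B"
    using rtrancl_imp_walk by metis
  moreover from this obtain ys where "walk S W ys" "distinct ys" "hd ys = hd xs" "last ys = last xs"
    using walk_imp_distinct by metis
  ultimately have "ys \<in> paths S W A B" by (simp add: paths_def)
  then show "paths S W A B \<noteq> {}" by blast
next
  assume "paths S W A B \<noteq> {}"
  then obtain xs where "walk S W xs" "hd xs \<in> A" "last xs \<in> B" by (auto simp: paths_def)
  then show "conn S W A B" using walk_cn[of S W xs "hd xs" A "last xs" B] by (auto simp: walk_def)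
qed

lemma finite_paths: "finite W \<Longrightarrow> finite (paths S W A B)"
  by (rule finite_subset[OF _ finite_subset_distinct[of W]]) (auto simp: paths_def walk_def)

section \<open>The order on paths and the stability of its minimum\<close>

definition vord :: "(vertex \<times> vertex) set" where
  "vord = {((x, y, z), (x', y', z')). z > z' \<or> z = z' \<and> (x < x' \<or> x = x' \<and> y < y')}"

lemma vord_total: "a \<noteq> b \<Longrightarrow> (a, b) \<in> vord \<or> (b, a) \<in> vord"
  by (cases a; cases b) (auto simp: vord_def)

lemma vord_asym: "(a, b) \<in> vord \<Longrightarrow> (b, a) \<notin> vord"
  by (cases a; cases b) (auto simp: vord_def)

lemma vord_trans: "trans vord"
  by (auto simp: trans_def vord_def)

lemma lexord_vord_asym: "(a, b) \<in> lexord vord \<Longrightarrow> (b, a) \<notin> lexord vord"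
  using vord_asym by (intro lexord_asymmetric[of vord]) (auto simp: asym_on_def)

lemma lexord_vord_irrefl: "(a, a) \<notin> lexord vord"
  using lexord_vord_asym by blast

lemma lexord_vord_total: "a \<noteq> b \<Longrightarrow> (a, b) \<in> lexord vord \<or> (b, a) \<in> lexord vord"
  using total_lexord[of vord] vord_total by (auto simp: total_on_def)

lemma lexord_vord_trans: "(a, b) \<in> lexord vord \<Longrightarrow> (b, c) \<in> lexord vord \<Longrightarrow> (a, c) \<in> lexord vord"
  using lexord_transI[OF vord_trans] by (meson transD)

definition lexmin :: "edge set \<Rightarrow> vertex set \<Rightarrow> vertex set \<Rightarrow> vertex set \<Rightarrow> vertex list \<Rightarrow> bool" where
  "lexmin S W A B xs \<longleftrightarrow>
     xs \<in> paths S W A B \<and> (\<forall>ys\<in>paths S W A B. ys \<noteq> xs \<longrightarrow> (xs, ys) \<in> lexord vord)"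

lemma lexmin_unique: "lexmin S W A B xs \<Longrightarrow> lexmin S W A B ys \<Longrightarrow> xs = ys"
  unfolding lexmin_def using lexord_vord_asym by metis

lemma finite_lexord_min:
  "finite P \<Longrightarrow> P \<noteq> {} \<Longrightarrow> \<exists>xs\<in>P. \<forall>ys\<in>P. ys \<noteq> xs \<longrightarrow> (xs, ys) \<in> lexord vord"
proof (induction P rule: finite_ne_induct)
  case (insert a P)
  then obtain xs where xs: "xs \<in> P" "\<forall>ys\<in>P. ys \<noteq> xs \<longrightarrow> (xs, ys) \<in> lexord vord" by auto
  have "a \<noteq> xs" using xs insert by auto
  then consider "(xs, a) \<in> lexord vord" | "(a, xs) \<in> lexord vord"
    using lexord_vord_total by blast
  then show ?case
  proof cases
    case 1
    then show ?thesis using xs by auto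
  next
    case 2
    then have "\<forall>ys\<in>P. (a, ys) \<in> lexord vord" using xs lexord_vord_trans by metis
    then show ?thesis by auto
  qed
qed simp

lemma lexmin_exists: "finite W \<Longrightarrow> conn S W A B \<Longrightarrow> \<exists>xs. lexmin S W A B xs"
  unfolding lexmin_def conn_iff_paths using finite_lexord_min[OF finite_paths] by blast

text \<open>Serves to cut a path of a modified configuration at its first new edge; what precedes is
  a path of the old configuration.\<close>

lemma successively_first_use:
  "successively (\<lambda>a b. P a b \<or> Q a b) xs \<Longrightarrow>
   successively P xs \<or> (\<exists>\<rho> u v \<tau>. xs = \<rho> @ u # v # \<tau> \<and> successively P (\<rho> @ [u]) \<and> Q u v)"
proof (induction xs)
  case (Cons a xs)
  show ?case
  proof (cases xs)
    case (Cons b ys)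
    note xs = Cons
    show ?thesis
    proof (cases "P a b")
      case True
      have "successively (\<lambda>a b. P a b \<or> Q a b) xs" using Cons.prems xs by auto
      from Cons.IH[OF this] show ?thesis
      proof
        assume "successively P xs"
        then show ?thesis using xs True by auto
      next
        assume "\<exists>\<rho> u v \<tau>. xs = \<rho> @ u # v # \<tau> \<and> successively P (\<rho> @ [u]) \<and> Q u v"
        then obtain \<rho> u v \<tau> where *: "xs = \<rho> @ u # v # \<tau>" "successively P (\<rho> @ [u])" "Q u v" by auto
        have "successively P ((a # \<rho>) @ [u])"
          using *(1,2) xs True by (cases \<rho>) auto
        then show ?thesis using * by (intro disjI2 exI[of _ "a # \<rho>"]) auto
      qed
    next
      case False
      then have "Q a b" using Cons.prems xs by auto
      then show ?thesis using xs by (intro disjI2 exI[of _ "[]"]) auto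
    qed
  qed simp
qed simp

text \<open>As \<open>x\<close> occurs only at the end of each extended list, neither of them is a
  proper prefix of the other, so a first difference exists.\<close>

lemma snoc_first_difference:
  "x \<notin> set a \<Longrightarrow> x \<notin> set b \<Longrightarrow> a \<noteq> b \<Longrightarrow>
   \<exists>c u v r s. a @ [x] = c @ u # r \<and> b @ [x] = c @ v # s \<and> u \<noteq> v"
proof (induction a arbitrary: b)
  case Nil
  then show ?case by (cases b) (auto intro!: exI[of _ "[]"])
next
  case (Cons a as)
  show ?case
  proof (cases b)
    case Nil
    then show ?thesis using Cons.prems by (auto intro!: exI[of _ "[]"])
  next
    case (Cons b' bs)
    show ?thesis
    proof (cases "a = b'")
      case True
      then obtain c u v r s where "as @ [x] = c @ u # r" "bs @ [x] = c @ v # s" "u \<noteq> v"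
        using Cons.IH[of bs] Cons.prems Cons by auto
      then show ?thesis using True Cons by (intro exI[of _ "a # c"]) auto
    next
      case False
      then show ?thesis using Cons by (intro exI[of _ "[]"]) auto
    qed
  qed
qed

text \<open>New edges \<open>L\<close> do not spoil minimality if a path can enter \<open>L\<close> only through an edge from a vertex
  \<open>g\<close> of the minimal path to a neighbour \<open>d\<close> that comes last in the order: a path that deviates from
  the minimal one before \<open>g\<close> and is smaller could be spliced with it into a smaller path
  avoiding \<open>L\<close>.\<close>
lemma lexmin_stable:
  assumes min: "lexmin S W A B \<gamma>" and open': "walk S' W \<gamma>"
    and S': "S' \<subseteq> S0 \<union> L" "S0 \<subseteq> S"
    and first: "\<And>\<rho> u v. walk S0 W (\<rho> @ [u]) \<Longrightarrow> hd (\<rho> @ [u]) \<in> A \<Longrightarrow> {u, v} \<in> L \<Longrightarrow> u = g \<and> v = d"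
    and g: "g \<in> set \<gamma>" and d: "\<And>n. n \<in> set \<gamma> \<Longrightarrow> {g, n} \<in> S \<Longrightarrow> (n, d) \<in> vord"
  shows "lexmin S' W A B \<gamma>"
proof -
  have \<gamma>: "walk S W \<gamma>" "distinct \<gamma>" "hd \<gamma> \<in> A" "last \<gamma> \<in> B"
    using min by (auto simp: lexmin_def paths_def)
  have "(\<gamma>, \<pi>) \<in> lexord vord" if \<pi>: "\<pi> \<in> paths S' W A B" "\<pi> \<noteq> \<gamma>" for \<pi>
  proof -
    have \<pi>': "walk S' W \<pi>" "distinct \<pi>" "hd \<pi> \<in> A" "last \<pi> \<in> B"
      using \<pi> by (auto simp: paths_def)
    have "successively (\<lambda>a b. {a, b} \<in> S0 \<or> {a, b} \<in> L) \<pi>"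
      using \<pi>'(1) S' by (auto simp: walk_def intro: successively_mono)
    from successively_first_use[OF this] show ?thesis
    proof
      assume "successively (\<lambda>a b. {a, b} \<in> S0) \<pi>"
      then have "walk S W \<pi>" using \<pi>'(1) S' by (auto simp: walk_def intro: successively_mono)
      then have "\<pi> \<in> paths S W A B" using \<pi>' by (auto simp: paths_def)
      then show ?thesis using min \<pi>(2) by (auto simp: lexmin_def)
    next
      assume "\<exists>\<rho> u v \<tau>. \<pi> = \<rho> @ u # v # \<tau> \<and> successively (\<lambda>a b. {a, b} \<in> S0) (\<rho> @ [u]) \<and> {u, v} \<in> L"
      then obtain \<rho> u v \<tau> where *: "\<pi> = \<rho> @ u # v # \<tau>" "successively (\<lambda>a b. {a, b} \<in> S0) (\<rho> @ [u])" "{u, v} \<in> L"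
        by auto
      have w0: "walk S0 W (\<rho> @ [u])" using * \<pi>'(1) by (auto simp: walk_def)
      moreover have hd0: "hd (\<rho> @ [u]) \<in> A" using * \<pi>'(3) by (cases \<rho>) auto
      ultimately have uv: "u = g" "v = d" using first *(3) by auto
      have succ: "successively (\<lambda>a b. {a, b} \<in> S) (\<rho> @ [g])"
        using *(2) uv S'(2) by (auto intro: successively_mono)
      obtain \<gamma>0 \<gamma>1 where split: "\<gamma> = \<gamma>0 @ g # \<gamma>1" using g by (auto simp: in_set_conv_decomp)
      show ?thesis
      \<comment> \<open>If \<open>\<pi>\<close> agrees with \<open>\<gamma>\<close> up to
        \<open>g\<close>, it goes on to \<open>d\<close>, while \<open>\<gamma>\<close> either ends
        at \<open>g\<close> or goes on to a smaller neighbour.\<close>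
      proof (cases "\<rho> = \<gamma>0")
        case True
        show ?thesis
        proof (cases \<gamma>1)
          case Nil
          then show ?thesis using True *(1) uv split lexord_append_leftI[of "[g]" "g # d # \<tau>" vord] by (cases d) auto
        next
          case (Cons n \<gamma>2)
          then have "{g, n} \<in> S" using \<gamma>(1) split by (auto simp: walk_def successively_append_iff)
          then have "(n, d) \<in> vord" using d Cons split by auto
          then show ?thesis using True *(1) uv split Cons by (auto intro!: lexord_append_leftI)
        qed
      next
        case False
        have "g \<notin> set \<rho>" "g \<notin> set \<gamma>0" using \<pi>'(2) *(1) uv \<gamma>(2) split by auto
        then obtain c a b r s where diff: "\<rho> @ [g] = c @ a # r" "\<gamma>0 @ [g] = c @ b # s" "a \<noteq> b"
          using snoc_first_difference False by metis
        have \<gamma>eq: "\<gamma> = c @ b # s @ \<gamma>1" using split diff(2) by (metis append.assoc append_Cons append_Nil)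
        have \<pi>eq: "\<pi> = c @ a # r @ d # \<tau>"
          using *(1) uv diff(1) by (metis append.assoc append_Cons append_Nil)
        show ?thesis
        proof (cases "(b, a) \<in> vord")
          case True
          then show ?thesis unfolding \<gamma>eq \<pi>eq by (auto intro!: lexord_append_leftI)
        next
          case False
          then have ab: "(a, b) \<in> vord" using vord_total diff(3) by blast
          \<comment> \<open>The detour of \<open>\<pi>\<close> leads to \<open>g\<close>, so it
            returns to \<open>\<gamma>\<close>; \<open>x\<close> is the first return and
            \<open>ys\<close> the part of the detour before it.\<close>
          have "g \<in> set (a # r)"
            using diff(1) by (metis last_appendR last_in_set last_snoc list.distinct(1))
          then have "\<exists>x\<in>set (a # r). x \<in> set \<gamma>" using g by auto
          then obtain ys x zs where spl: "a # r = ys @ x # zs" "x \<in> set \<gamma>" "\<forall>y\<in>set ys. y \<notin> set \<gamma>"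
            using split_list_first_prop[of "a # r" "\<lambda>x. x \<in> set \<gamma>"] by auto
          have dist: "distinct (c @ ys @ x # zs)"
            using \<pi>'(2) spl(1) unfolding \<pi>eq by (metis append.assoc append_Cons distinct_append)
          then have "x \<notin> set c" by auto
          then have "x \<in> set (b # s @ \<gamma>1)" using spl(2) \<gamma>eq by auto
          then obtain ta tb where t: "b # s @ \<gamma>1 = ta @ x # tb" by (meson split_list)
          have \<gamma>eq2: "\<gamma> = c @ ta @ x # tb" using \<gamma>eq t by simp
          \<comment> \<open>Follow \<open>\<pi>\<close> up to \<open>x\<close> and
            \<open>\<gamma>\<close> from there on. This path uses only edges of \<open>S\<close>,
            and at the first difference it is smaller than \<open>\<gamma>\<close>.\<close>
          define \<sigma> where "\<sigma> = (c @ ys) @ x # tb"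
          have pre: "\<rho> @ [g] = (c @ ys @ [x]) @ zs" using diff(1) spl(1) by simp
          have "successively (\<lambda>a b. {a, b} \<in> S) ((c @ ys) @ [x])"
            using succ unfolding pre by (subst (asm) successively_append_iff) simp
          moreover have "successively (\<lambda>a b. {a, b} \<in> S) (x # tb)"
            using \<gamma>(1) unfolding \<gamma>eq2 walk_def by (auto simp: successively_append_iff)
          ultimately have "successively (\<lambda>a b. {a, b} \<in> S) \<sigma>"
            unfolding \<sigma>_def by (rule successively_glue)
          moreover have "set \<sigma> \<subseteq> W"
          proof -
            have "set (c @ ys @ [x]) \<subseteq> set (\<rho> @ [g])" unfolding pre by auto
            also have "\<dots> \<subseteq> W" using w0 uv by (auto simp: walk_def)
            finally have "set (c @ ys @ [x]) \<subseteq> W" .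
            moreover have "set tb \<subseteq> W" using \<gamma>(1) unfolding \<gamma>eq2 walk_def by auto
            ultimately show ?thesis by (auto simp: \<sigma>_def)
          qed
          moreover have "distinct \<sigma>"
            using dist \<gamma>(2) spl(3) unfolding \<sigma>_def \<gamma>eq2 by auto
          moreover have "hd \<sigma> = hd (\<rho> @ [g])"
            unfolding pre \<sigma>_def by (auto simp: hd_append)
          moreover have "last \<sigma> = last \<gamma>" unfolding \<sigma>_def \<gamma>eq2 by simp
          ultimately have "\<sigma> \<in> paths S W A B"
            using hd0 uv \<gamma>(4) by (auto simp: paths_def walk_def \<sigma>_def)
          moreover have lt: "(\<sigma>, \<gamma>) \<in> lexord vord"
            using ab spl(1) unfolding \<sigma>_def \<gamma>eq by (cases ys) (auto intro!: lexord_append_leftI)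
          ultimately have False
            using min lexord_vord_asym lexord_vord_irrefl unfolding lexmin_def by metis
          then show ?thesis ..
        qed
      qed
    qed
  qed
  then show ?thesis
    using \<gamma> open' by (auto simp: lexmin_def paths_def)
qed


section \<open>Vertical surgery and gluing\<close>

definition base :: "vertex \<Rightarrow> int \<times> int" where "base v = (fst v, fst (snd v))"

definition ht :: "vertex \<Rightarrow> int" where "ht v = snd (snd v)"

lemma base_simp [simp]: "base (x, y, z) = (x, y)" by (simp add: base_def)

lemma ht_simp [simp]: "ht (x, y, z) = z" by (simp add: ht_def)

text \<open>Links are vertical, so regions are required to be unions of full columns: a link between
  two vertices of a region then stays inside it.\<close>

definition colfull :: "nat \<Rightarrow> vertex set \<Rightarrow> bool" where
  "colfull k W \<longleftrightarrow> W \<subseteq> slab k \<and> (\<forall>u\<in>W. \<forall>v\<in>slab k. base v = base u \<longrightarrow> v \<in> W)"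

definition inc :: "vertex set \<Rightarrow> vertex \<Rightarrow> edge set" where
  "inc V g = {e \<in> edges_on V. \<exists>v\<in>e. base v = base g}"

definition cluster :: "edge set \<Rightarrow> vertex set \<Rightarrow> vertex set \<Rightarrow> vertex set" where
  "cluster S R C = {v. \<exists>c\<in>C \<inter> R. (c, v) \<in> (stp S R)\<^sup>*}"

text \<open>The mark left by the surgery. While \<open>C\<close> is not connected to
  \<open>\<gamma>\<close> there is no such vertex; a link from the cluster of \<open>C\<close> to
  \<open>g\<close> makes \<open>g\<close> the only one.\<close>

definition landing :: "edge set \<Rightarrow> vertex set \<Rightarrow> vertex set \<Rightarrow> vertex list \<Rightarrow> vertex \<Rightarrow> bool" where
  "landing S R C \<gamma> g \<longleftrightarrow> g \<in> set \<gamma> \<and> conn S (R - set \<gamma> \<union> {g}) C {g}"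

lemma nn_sym: "nn u v \<Longrightarrow> nn v u"
  by (auto simp: nn_def)

lemma edges_onD: "{u, v} \<in> edges_on V \<Longrightarrow> u \<in> V \<and> v \<in> V \<and> nn u v"
  by (auto simp: edges_on_def doubleton_eq_iff intro: nn_sym)

lemma edges_onI: "u \<in> V \<Longrightarrow> v \<in> V \<Longrightarrow> nn u v \<Longrightarrow> {u, v} \<in> edges_on V"
  unfolding edges_on_def by blast

lemma edges_on_mono: "V \<subseteq> W \<Longrightarrow> edges_on V \<subseteq> edges_on W"
  unfolding edges_on_def by blast

lemma finite_edges_on: "finite V \<Longrightarrow> finite (edges_on V)"
  by (rule finite_subset[of _ "Pow V"]) (auto simp: edges_on_def)

text \<open>Each of the \<open>k + 1\<close> vertices of a column has at most six incident
  edges.\<close>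

lemma card_inc:
  assumes "V \<subseteq> slab k"
  shows "finite (inc V g) \<and> card (inc V g) \<le> 6 * (k + 1)"
proof -
  obtain x y l where g: "g = (x, y, l)" by (cases g)
  define D :: "vertex set" where "D = {(1,0,0), (-1,0,0), (0,1,0), (0,-1,0), (0,0,1), (0,0,-1)}"
  have D: "finite D" "card D = 6" unfolding D_def by auto
  let ?h = "\<lambda>(z, (dx, dy, dz)). {(x, y, z), (x + dx, y + dy, z + dz)}"
  have "inc V g \<subseteq> ?h ` ({0..int k} \<times> D)"
  proof
    fix e assume "e \<in> inc V g"
    then have "e \<in> edges_on V" "\<exists>u\<in>e. base u = (x, y)" by (auto simp: inc_def g)
    then obtain a b where ab: "e = {a, b}" "a \<in> V" "b \<in> V" "nn a b" "base a = (x, y) \<or> base b = (x, y)"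
      unfolding edges_on_def by blast
    then obtain u v where e: "e = {u, v}" "u \<in> V" "nn u v" "base u = (x, y)"
      using nn_sym[of a b] insert_commute[of a b "{}"] by metis
    obtain z where u: "u = (x, y, z)" using e(4) by (cases u) auto
    obtain x' y' z' where v: "v = (x', y', z')" by (cases v)
    have z: "z \<in> {0..int k}" using assms e(2) u by (auto simp: slab_def)
    have "\<bar>x - x'\<bar> + \<bar>y - y'\<bar> + \<bar>z - z'\<bar> = 1" using e(3) u v by (simp add: nn_def)
    then have "(x' - x, y' - y, z' - z) \<in> D" unfolding D_def by simp presburger
    moreover have "e = ?h (z, (x' - x, y' - y, z' - z))" using e(1) u v by simp
    ultimately show "e \<in> ?h ` ({0..int k} \<times> D)" using z by blast
  qed
  moreover have "finite (?h ` ({0..int k} \<times> D))" using D by auto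
  moreover have "card (?h ` ({0..int k} \<times> D)) \<le> 6 * (k + 1)"
    using card_image_le[of "{0..int k} \<times> D" ?h] D by (simp add: card_cartesian_product mult.commute)
  ultimately show ?thesis by (meson card_mono finite_subset le_trans)
qed

lemma walk_change: "walk S W xs \<Longrightarrow> (\<And>e. e \<in> S \<Longrightarrow> e \<subseteq> set xs \<Longrightarrow> e \<in> S') \<Longrightarrow> set xs \<subseteq> W' \<Longrightarrow> walk S' W' xs"
  unfolding walk_def by (auto elim!: successively_mono)

lemma cluster_disjoint:
  assumes "\<not> conn S R A C" "v \<in> cluster S R C" "a \<in> A" "a \<in> R"
  shows "(a, v) \<notin> (stp S R)\<^sup>*"
proof
  assume "(a, v) \<in> (stp S R)\<^sup>*"
  moreover obtain c where "c \<in> C" "(c, v) \<in> (stp S R)\<^sup>*"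
    using assms(2) unfolding cluster_def by blast
  moreover from this have "(v, c) \<in> (stp S R)\<^sup>*"
    using stp_rtrancl_sym by metis
  ultimately have "conn S R A C" unfolding conn_def using assms(3,4) by (meson IntI rtrancl_trans)
  then show False using assms(1) by simp
qed

lemma cluster_step: "u \<in> cluster S R C \<Longrightarrow> {u, v} \<in> S \<Longrightarrow> u \<in> R \<Longrightarrow> v \<in> R \<Longrightarrow> v \<in> cluster S R C"
  unfolding cluster_def stp_def by (auto intro: rtrancl_into_rtrancl)

lemma cluster_subset: "cluster S R C \<subseteq> R"
  unfolding cluster_def by (auto dest: stp_rtrancl_in)

text \<open>The vertical link from \<open>g\<close> down to the cluster of \<open>C\<close> starts with the neighbour of \<open>g\<close> that is last in
  the order \<open>vord\<close>; this is why a higher vertex counts as smaller there.\<close>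
lemma link_surgery:
  assumes S: "S \<subseteq> edges_on V" "R \<subseteq> V" "colfull k R" "colfull k A" "W \<subseteq> R"
    and min: "lexmin S W A B \<gamma>" and ncn: "\<not> conn S R A C"
    and g: "g \<in> set \<gamma>" and w: "w \<in> cluster S R C" and below: "base w = base g" "ht w < ht g"
    and closest: "\<And>h. base h = base g \<Longrightarrow> ht w < ht h \<Longrightarrow> ht h < ht g \<Longrightarrow> h \<notin> set \<gamma> \<and> h \<notin> cluster S R C"
  shows "\<exists>S'. S' \<subseteq> edges_on V \<and> conn S' R A C \<and> lexmin S' W A B \<gamma> \<and> (\<forall>y. landing S' R C \<gamma> y \<longleftrightarrow> y = g) \<and>
    S - inc V g = S' - inc V g"
proof -
  obtain x y l where gx: "g = (x, y, l)" by (cases g)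
  obtain j where wx: "w = (x, y, j)" "j < l" using below gx by (cases w) auto
  have \<gamma>: "walk S W \<gamma>" "distinct \<gamma>" "hd \<gamma> \<in> A" using min by (auto simp: lexmin_def paths_def)
  have \<gamma>ne: "\<gamma> \<noteq> []" "set \<gamma> \<subseteq> W" using \<gamma>(1) by (auto simp: walk_def)
  have reach: "(hd \<gamma>, v) \<in> (stp S R)\<^sup>*" if "v \<in> set \<gamma>" for v
    using walk_hd_rtrancl[OF \<gamma>(1) that] stp_rtrancl_mono[OF order_refl S(5)] by blast
  have hdR: "hd \<gamma> \<in> R" using \<gamma>ne S(5) hd_in_set by blast
  have \<gamma>clu: "v \<notin> cluster S R C" if "v \<in> set \<gamma>" for v
    using cluster_disjoint[OF ncn _ \<gamma>(3) hdR] reach[OF that] by blast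
  have gR: "g \<in> R" and wR: "w \<in> R" using g \<gamma>ne S(5) w cluster_subset by blast+
  then have rng: "0 \<le> j" "l \<le> int k" using S(3) gx wx by (auto simp: colfull_def slab_def)
  have colR: "(x, y, h) \<in> R" if "j \<le> h" "h \<le> l" for h
    using S(3) gR rng that gx unfolding colfull_def slab_def by auto
  \<comment> \<open>\<open>L\<close> is the vertical link from \<open>w\<close> to \<open>g\<close>
    and \<open>I\<close> its interior. All old edges at \<open>I\<close> are closed, so the link can
    be entered only at its two ends.\<close>
  define I where "I = {(x, y, h) | h. j < h \<and> h < l}"
  define L where "L = {{(x, y, h), (x, y, h + 1)} | h. j \<le> h \<and> h < l}"
  define S0 where "S0 = {e \<in> S. e \<inter> I = {}}"
  define S' where "S' = S0 \<union> L"
  have I\<gamma>: "v \<notin> set \<gamma>" and Iclu: "v \<notin> cluster S R C" if "v \<in> I" for v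
    using closest[of v] that gx wx by (auto simp: I_def)
  have LV: "L \<subseteq> edges_on V"
  proof
    fix e assume "e \<in> L"
    then obtain h where "e = {(x, y, h), (x, y, h + 1)}" "j \<le> h" "h < l" by (auto simp: L_def)
    then show "e \<in> edges_on V" using colR[of h] colR[of "h + 1"] S(2) by (auto intro!: edges_onI simp: nn_def)
  qed
  then have S'V: "S' \<subseteq> edges_on V" using S(1) by (auto simp: S'_def S0_def)
  have \<gamma>S0: "walk S0 W \<gamma>"
    using \<gamma>(1) by (rule walk_change) (use I\<gamma> \<gamma>ne in \<open>auto simp: S0_def\<close>)
  then have \<gamma>S': "walk S' W \<gamma>" by (rule walk_change) (use \<gamma>ne in \<open>auto simp: S'_def\<close>)
  define X where "X = R - set \<gamma> \<union> {g}"
  have XR: "X \<subseteq> R" using gR by (auto simp: X_def)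
  obtain c where c: "c \<in> C" "c \<in> R" "(c, w) \<in> (stp S R)\<^sup>*" using w by (auto simp: cluster_def)
  \<comment> \<open>The cluster of \<open>C\<close> avoids both \<open>I\<close> and
    \<open>\<gamma>\<close>, hence its connections survive the closing of edges and stay off
    \<open>\<gamma>\<close>.\<close>
  have cX: "(c, v) \<in> (stp S' X)\<^sup>*" if "(c, v) \<in> (stp S R)\<^sup>*" for v
    using that
  proof (induction rule: rtrancl_induct)
    case (step a b)
    have "a \<in> cluster S R C" "b \<in> cluster S R C"
      using step.hyps c unfolding cluster_def by (auto intro: rtrancl_into_rtrancl)
    then have "a \<notin> set \<gamma>" "b \<notin> set \<gamma>" "a \<notin> I" "b \<notin> I"
      using \<gamma>clu Iclu by blast+
    then have "(a, b) \<in> stp S' X"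
      using step.hyps(2) by (auto simp: stp_def S'_def S0_def X_def)
    then show ?case using step.IH by simp
  qed simp
  have link: "(w, (x, y, h)) \<in> (stp S' X)\<^sup>*" if "j \<le> h" "h \<le> l" for h
    using that
  proof (induction h rule: int_ge_induct)
    case (step h)
    have inX: "(x, y, i) \<in> X" if "j \<le> i" "i \<le> l" for i
    proof (cases "i = l \<or> i = j")
      case True
      then show ?thesis using gx wx wR \<gamma>clu w by (auto simp: X_def)
    next
      case False
      then have "(x, y, i) \<in> I" using that by (auto simp: I_def)
      then show ?thesis using I\<gamma> colR that by (auto simp: X_def)
    qed
    have "{(x, y, h), (x, y, h + 1)} \<in> S'" using step by (auto simp: S'_def L_def)
    then have "((x, y, h), (x, y, h + 1)) \<in> stp S' X" using inX step by (auto simp: stp_def)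
    then show ?case using step by (auto intro: rtrancl_into_rtrancl)
  qed (simp add: wx)
  have cg: "(c, g) \<in> (stp S' X)\<^sup>*" using cX[OF c(3)] link[of l] gx wx by auto
  have "c \<in> cluster S R C" using c unfolding cluster_def by blast
  then have "c \<notin> set \<gamma>" using \<gamma>clu by blast
  then have cInX: "c \<in> X" using c(2) by (simp add: X_def)
  have "conn S' R A C"
  proof -
    have "(hd \<gamma>, g) \<in> (stp S' R)\<^sup>*"
      using walk_hd_rtrancl[OF \<gamma>S' g] stp_rtrancl_mono[OF order_refl S(5)] by blast
    moreover have "(g, c) \<in> (stp S' R)\<^sup>*"
      using stp_rtrancl_mono[OF order_refl XR] stp_rtrancl_sym[OF cg] by blast
    ultimately show ?thesis unfolding conn_def using \<gamma>(3) hdR c(1) by (meson IntI rtrancl_trans)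
  qed
  moreover have "lexmin S' W A B \<gamma>"
  proof (rule lexmin_stable[OF min \<gamma>S', of S0 L g "(x, y, l - 1)"])
    fix \<rho> u v assume \<rho>: "walk S0 W (\<rho> @ [u])" "hd (\<rho> @ [u]) \<in> A" "{u, v} \<in> L"
    have "walk S R (\<rho> @ [u])" using \<rho>(1)
      by (rule walk_change) (use \<rho>(1) S(5) in \<open>auto simp: S0_def walk_def\<close>)
    then have reach: "(hd (\<rho> @ [u]), u) \<in> (stp S R)\<^sup>*" "hd (\<rho> @ [u]) \<in> R"
      using walk_hd_rtrancl[of S R "\<rho> @ [u]" u] hd_in_set[of "\<rho> @ [u]"] by (auto simp: walk_def)
    have uclu: "u \<notin> cluster S R C" using cluster_disjoint[OF ncn _ \<rho>(2) reach(2)] reach(1) by blast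
    obtain h where h: "{u, v} = {(x, y, h), (x, y, h + 1)}" "j \<le> h" "h < l" using \<rho>(3) by (auto simp: L_def)
    have "u \<notin> I"
    proof
      assume uI: "u \<in> I"
      show False
      proof (cases \<rho> rule: rev_cases)
        case Nil
        then have "u \<in> A" "u \<in> R" using \<rho>(2) reach(2) by auto
        \<comment> \<open>With its old edges closed, a vertex of \<open>I\<close> can only be the
          start of the path. As \<open>A\<close> consists of full columns, \<open>w\<close> would be
          in \<open>A\<close> and in the cluster of \<open>C\<close>.\<close>
        then have "w \<in> A" using S(3,4) wR uI wx unfolding colfull_def I_def by auto
        then show False using cluster_disjoint[OF ncn w _ wR] by blast
      next
        case (snoc \<rho>' u')
        then have "{u', u} \<in> S0" using \<rho>(1) by (auto simp: walk_def successively_append_iff)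
        then show False using uI by (auto simp: S0_def)
      qed
    qed
    then show "u = g \<and> v = (x, y, l - 1)"
    proof -
      have lo: "(x, y, i) = w \<or> (x, y, i) \<in> I" if "j \<le> i" "i < l" for i using that wx by (auto simp: I_def)
      have nu: "u \<noteq> (x, y, i)" if "j \<le> i" "i < l" for i using lo[OF that] uclu \<open>u \<notin> I\<close> w by auto
      then have "u = (x, y, h + 1) \<and> v = (x, y, h)" "\<not> h + 1 < l"
        using h nu[of h] nu[of "h + 1"] by (auto simp: doubleton_eq_iff)
      then show ?thesis using h(3) gx by auto
    qed
  next
    fix n assume n: "n \<in> set \<gamma>" "{g, n} \<in> S"
    have "n \<noteq> (x, y, l - 1)"
    proof
      assume nd: "n = (x, y, l - 1)"
      then have "n = w \<or> n \<in> I" using wx by (auto simp: I_def)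
      then show False using n(1) \<gamma>clu I\<gamma> w by blast
    qed
    moreover have "nn g n" using n(2) S(1) edges_onD by blast
    ultimately show "(n, (x, y, l - 1)) \<in> vord"
      unfolding gx by (cases n) (auto simp: nn_def vord_def)
  qed (use g in \<open>auto simp: S'_def S0_def\<close>)
  moreover have "landing S' R C \<gamma> v \<longleftrightarrow> v = g" for v
  proof
    assume "v = g"
    then show "landing S' R C \<gamma> v" using g c(1) cInX cg unfolding landing_def X_def conn_def by blast
  next
    assume land: "landing S' R C \<gamma> v"
    then obtain c' where c': "c' \<in> C" "c' \<in> R - set \<gamma> \<union> {v}" "(c', v) \<in> (stp S' (R - set \<gamma> \<union> {v}))\<^sup>*"
      and v: "v \<in> set \<gamma>" by (auto simp: landing_def conn_def)
    have vR: "v \<in> R" using v \<gamma>ne S(5) by auto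
    show "v = g"
    proof (rule ccontr)
      assume vg: "v \<noteq> g"
      \<comment> \<open>A connection from \<open>C\<close> that meets \<open>\<gamma>\<close> only
        in \<open>v\<close> cannot pass through \<open>g\<close>. It stays in the old cluster or in
        the interior of the link, and neither contains a vertex of \<open>\<gamma>\<close>.\<close>
      from c'(3) have "v \<in> cluster S R C \<union> I"
      proof (induction rule: rtrancl_induct)
        case base
        have "c' \<in> R" using c'(2) vR by auto
        then show ?case using c'(1) by (auto simp: cluster_def)
      next
        case (step a b)
        then have ab: "a \<in> R" "b \<in> R" "b \<in> R - set \<gamma> \<union> {v}" "{a, b} \<in> S'" using vR by (auto simp: stp_def)
        show ?case
        proof (cases "{a, b} \<in> L")
          case True
          then obtain h where h: "{a, b} = {(x, y, h), (x, y, h + 1)}" "j \<le> h" "h < l" by (auto simp: L_def)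
          have "b \<noteq> g" using ab(3) g vg by auto
          then have "b = w \<or> b \<in> I" using h unfolding gx wx(1) I_def by (auto simp: doubleton_eq_iff)
          then show ?thesis using w by auto
        next
          case False
          then have "{a, b} \<in> S" "a \<notin> I" using ab(4) by (auto simp: S'_def S0_def)
          then show ?thesis using step.IH ab cluster_step by auto
        qed
      qed
      then show False using v \<gamma>clu I\<gamma> by blast
    qed
  qed
  moreover have "S - inc V g = S' - inc V g"
  proof -
    have "e \<in> S0" if "e \<in> S" "e \<notin> inc V g" for e
    proof -
      have "e \<in> edges_on V" using that S(1) by auto
      then have "v \<notin> I" if "v \<in> e" for v using \<open>e \<notin> inc V g\<close> that gx unfolding inc_def I_def by auto
      then show ?thesis using that by (auto simp: S0_def)
    qed
    moreover have "L \<subseteq> inc V g" using LV gx by (auto simp: inc_def L_def)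
    ultimately show ?thesis by (auto simp: S'_def S0_def)
  qed
  ultimately show ?thesis using S'V by blast
qed

definition (in bernoulli) glue_const :: "nat \<Rightarrow> real" where
  "glue_const k = (2 / min p (1 - p)) ^ (6 * (k + 1))"

text \<open>\<open>root\<close> reads the place of the surgery off the modified configuration:
  \<open>\<gamma>\<close> is still minimal there, and \<open>g\<close> is its unique landing vertex.
  All altered edges touch the column of \<open>g\<close>, which is what \<open>pr_surgery\<close>
  asks for.\<close>

lemma (in bernoulli) pr_link:
  assumes "finite V" "V \<subseteq> slab k" "R \<subseteq> V" "colfull k R" "colfull k A" "W \<subseteq> R"
  shows "pr (edges_on V) (\<lambda>S. (\<exists>\<gamma> g w. lexmin S W A B \<gamma> \<and> g \<in> set \<gamma> \<and> w \<in> cluster S R C \<and> base w = base g \<and> ht w < ht g) \<and>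
      \<not> conn S R A C) \<le> glue_const k * pr (edges_on V) (\<lambda>S. conn S R A C)"
proof -
  define root where "root S' = (SOME g. \<exists>\<gamma>. lexmin S' W A B \<gamma> \<and> landing S' R C \<gamma> g)" for S'
  show ?thesis
    unfolding glue_const_def
  proof (rule pr_surgery[of _ "\<lambda>S'. inc V (root S')"])
    fix S assume S: "S \<subseteq> edges_on V"
      "(\<exists>\<gamma> g w. lexmin S W A B \<gamma> \<and> g \<in> set \<gamma> \<and> w \<in> cluster S R C \<and> base w = base g \<and> ht w < ht g) \<and> \<not> conn S R A C"
    then obtain \<gamma> where \<gamma>: "lexmin S W A B \<gamma>"
      and ex: "\<exists>g w. g \<in> set \<gamma> \<and> w \<in> cluster S R C \<and> base w = base g \<and> ht w < ht g" by blast
    define Q where "Q = (\<lambda>(g, w). g \<in> set \<gamma> \<and> w \<in> cluster S R C \<and> base w = base g \<and> ht w < ht g)"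
    have "\<exists>gw. Q gw" using ex unfolding Q_def by simp
    \<comment> \<open>A pair at least vertical distance has no vertex of \<open>\<gamma>\<close> or
      of the cluster strictly between its members, as \<open>link_surgery\<close> demands.\<close>
    then obtain gw where gw: "Q gw" "\<And>gw'. Q gw' \<Longrightarrow> nat (ht (fst gw) - ht (snd gw)) \<le> nat (ht (fst gw') - ht (snd gw'))"
      using ex_has_least_nat[of Q _ "\<lambda>gw. nat (ht (fst gw) - ht (snd gw))"] by metis
    obtain g w where gweq: "gw = (g, w)" by (cases gw)
    have g: "g \<in> set \<gamma>" "w \<in> cluster S R C" "base w = base g" "ht w < ht g"
      using gw(1) unfolding gweq Q_def by auto
    have "\<exists>S'. S' \<subseteq> edges_on V \<and> conn S' R A C \<and> lexmin S' W A B \<gamma> \<and>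
      (\<forall>y. landing S' R C \<gamma> y \<longleftrightarrow> y = g) \<and> S - inc V g = S' - inc V g"
    proof (rule link_surgery[OF S(1) assms(3-6) \<gamma> _ g])
      fix h assume h: "base h = base g" "ht w < ht h" "ht h < ht g"
      have "\<not> Q (h, w)" "\<not> Q (g, h)"
        using gw(2)[of "(h, w)"] gw(2)[of "(g, h)"] h unfolding gweq by auto
      then show "h \<notin> set \<gamma> \<and> h \<notin> cluster S R C"
        using h g unfolding Q_def by auto
    qed (use S in simp)
    then obtain S' where S': "S' \<subseteq> edges_on V" "conn S' R A C" "lexmin S' W A B \<gamma>"
      "\<And>y. landing S' R C \<gamma> y \<longleftrightarrow> y = g" "S - inc V g = S' - inc V g" by blast
    have "root S' = g"
      unfolding root_def
    proof (rule some_equality)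
      fix g' assume "\<exists>\<gamma>. lexmin S' W A B \<gamma> \<and> landing S' R C \<gamma> g'"
      then show "g' = g" using lexmin_unique[OF S'(3)] S'(4) by blast
    qed (use S' in blast)
    then show "\<exists>S'. S' \<subseteq> edges_on V \<and> conn S' R A C \<and> S - inc V (root S') = S' - inc V (root S')"
      using S' by blast
  qed (use assms card_inc finite_edges_on in auto)
qed

text \<open>If two minimal paths visit a common column, then one of them has a vertex above a vertex of the
  cluster of the other.\<close>
lemma (in bernoulli) pr_glue:
  assumes "finite V" "V \<subseteq> slab k" "R \<subseteq> V" "colfull k R" "colfull k A" "colfull k C" "R1 \<subseteq> R" "R2 \<subseteq> R"
  shows "pr (edges_on V) (\<lambda>S. conn S R A C \<or> (\<exists>\<gamma> \<delta>. lexmin S R1 A B \<gamma> \<and> lexmin S R2 C D \<delta> \<and>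
      (\<exists>g\<in>set \<gamma>. \<exists>h\<in>set \<delta>. base g = base h)))
    \<le> (1 + 2 * glue_const k) * pr (edges_on V) (\<lambda>S. conn S R A C)" (is "pr ?E ?X \<le> _ * pr _ ?Y")
proof -
  let ?L = "\<lambda>R1 A B C S. (\<exists>\<gamma> g w. lexmin S R1 A B \<gamma> \<and> g \<in> set \<gamma> \<and> w \<in> cluster S R C \<and> base w = base g \<and> ht w < ht g) \<and>
      \<not> conn S R A C"
  have in_clu: "v \<in> cluster S R A" if "lexmin S R1 A B \<gamma>" "v \<in> set \<gamma>" "R1 \<subseteq> R" for S R1 A B \<gamma> v
  proof -
    have "walk S R1 \<gamma>" "hd \<gamma> \<in> A" using that by (auto simp: lexmin_def paths_def)
    moreover from this have "hd \<gamma> \<in> R" using that(3) hd_in_set unfolding walk_def by blast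
    moreover have "(hd \<gamma>, v) \<in> (stp S R)\<^sup>*"
      using walk_hd_rtrancl[OF \<open>walk S R1 \<gamma>\<close> that(2)] stp_rtrancl_mono[OF order_refl that(3)] by blast
    ultimately show ?thesis unfolding cluster_def by blast
  qed
  have "pr ?E ?X \<le> pr ?E ?Y + pr ?E (\<lambda>S. ?L R1 A B C S \<or> ?L R2 C D A S)"
  proof (rule pr_union2)
    fix S assume "?X S"
    show "?Y S \<or> (?L R1 A B C S \<or> ?L R2 C D A S)"
    proof (cases "?Y S")
      case False
      then obtain \<gamma> \<delta> g h where *: "lexmin S R1 A B \<gamma>" "lexmin S R2 C D \<delta>" "g \<in> set \<gamma>" "h \<in> set \<delta>" "base g = base h"
        using \<open>?X S\<close> by blast
      have g: "g \<in> cluster S R A" and h: "h \<in> cluster S R C" using * in_clu assms(7,8) by blast+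
      have "g \<noteq> h"
      proof
        assume "g = h"
        then obtain a where "a \<in> A" "a \<in> R" "(a, h) \<in> (stp S R)\<^sup>*" using g by (auto simp: cluster_def)
        then show False using cluster_disjoint[OF False h] by blast
      qed
      then have "ht g \<noteq> ht h" using *(5) by (cases g; cases h) auto
      then consider "ht h < ht g" | "ht g < ht h" by linarith
      then show ?thesis
      proof cases
        case 1
        then have "?L R1 A B C S" using * h False by metis
        then show ?thesis by simp
      next
        case 2
        then have "?L R2 C D A S" using * g False conn_commute by metis
        then show ?thesis by simp
      qed
    qed simp
  qed
  also have "\<dots> \<le> pr ?E ?Y + (pr ?E (?L R1 A B C) + pr ?E (?L R2 C D A))"
    by (intro add_left_mono pr_union2)
  also have "\<dots> \<le> pr ?E ?Y + (glue_const k * pr ?E (\<lambda>S. conn S R A C) + glue_const k * pr ?E (\<lambda>S. conn S R C A))"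
    using assms by (intro add_mono pr_link) auto
  also have "\<dots> = (1 + 2 * glue_const k) * pr ?E ?Y"
    unfolding conn_commute[of _ R C A] by (simp add: algebra_simps)
  finally show ?thesis .
qed

text \<open>FKG produces both crossings at once. The planar input enters through
  \<open>meet\<close>, which speaks of all paths and so covers the minimal ones.\<close>

lemma (in bernoulli) pr_glue_crossing:
  assumes "finite V" "V \<subseteq> slab k" "R \<subseteq> V" "colfull k R" "colfull k A" "colfull k C" "R1 \<subseteq> R" "R2 \<subseteq> R"
    and meet: "\<And>S \<gamma> \<delta>. S \<subseteq> edges_on V \<Longrightarrow> \<gamma> \<in> paths S R1 A B \<Longrightarrow> \<delta> \<in> paths S R2 C D \<Longrightarrow>
      \<exists>g\<in>set \<gamma>. \<exists>h\<in>set \<delta>. base g = base h"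
  shows "pr (edges_on V) (\<lambda>S. conn S R1 A B) * pr (edges_on V) (\<lambda>S. conn S R2 C D)
    \<le> (1 + 2 * glue_const k) * pr (edges_on V) (\<lambda>S. conn S R A C)"
proof -
  have fin: "finite (edges_on V)" "finite R1" "finite R2"
    using assms(1,3,7,8) finite_edges_on by (blast intro: finite_subset)+
  have "pr (edges_on V) (\<lambda>S. conn S R1 A B) * pr (edges_on V) (\<lambda>S. conn S R2 C D)
      \<le> pr (edges_on V) (\<lambda>S. conn S R1 A B \<and> conn S R2 C D)"
    using fin by (intro pr_fkg) (auto elim: conn_mono[rotated -1])
  also have "\<dots> \<le> pr (edges_on V) (\<lambda>S. conn S R A C \<or> (\<exists>\<gamma> \<delta>. lexmin S R1 A B \<gamma> \<and> lexmin S R2 C D \<delta> \<and>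
      (\<exists>g\<in>set \<gamma>. \<exists>h\<in>set \<delta>. base g = base h)))"
  proof (rule pr_mono)
    fix S assume S: "S \<subseteq> edges_on V" "conn S R1 A B \<and> conn S R2 C D"
    then obtain \<gamma> \<delta> where "lexmin S R1 A B \<gamma>" "lexmin S R2 C D \<delta>"
      using lexmin_exists fin by meson
    moreover from this have "\<exists>g\<in>set \<gamma>. \<exists>h\<in>set \<delta>. base g = base h"
      using meet[OF S(1)] by (simp add: lexmin_def)
    ultimately show "conn S R A C \<or> (\<exists>\<gamma> \<delta>. lexmin S R1 A B \<gamma> \<and> lexmin S R2 C D \<delta> \<and>
      (\<exists>g\<in>set \<gamma>. \<exists>h\<in>set \<delta>. base g = base h))" by blast
  qed
  also have "\<dots> \<le> (1 + 2 * glue_const k) * pr (edges_on V) (\<lambda>S. conn S R A C)"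
    using assms(1-8) by (rule pr_glue)
  finally show ?thesis .
qed

section \<open>Lattice paths in the plane\<close>

text \<open>Distance 0 is allowed because a vertical edge projects to a single point.\<close>

definition adj2 :: "int \<times> int \<Rightarrow> int \<times> int \<Rightarrow> bool" where
  "adj2 a b \<longleftrightarrow> \<bar>fst a - fst b\<bar> + \<bar>snd a - snd b\<bar> \<le> 1"

definition pt :: "int \<times> int \<Rightarrow> real^2" where
  "pt a = vector [real_of_int (fst a), real_of_int (snd a)]"

lemma pt_nth [simp]: "pt a $ 1 = real_of_int (fst a)" "pt a $ 2 = real_of_int (snd a)"
  by (auto simp: pt_def)

fun polyline :: "(int \<times> int) list \<Rightarrow> real \<Rightarrow> real^2" where
  "polyline [] = linepath 0 0"
| "polyline [a] = linepath (pt a) (pt a)"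
| "polyline (a # b # xs) = linepath (pt a) (pt b) +++ polyline (b # xs)"

lemma polyline_path:
  "xs \<noteq> [] \<Longrightarrow> path (polyline xs) \<and> pathstart (polyline xs) = pt (hd xs) \<and> pathfinish (polyline xs) = pt (last xs)"
  by (induction xs rule: polyline.induct) auto

lemma polyline_image:
  "xs \<noteq> [] \<Longrightarrow> successively adj2 xs \<Longrightarrow> z \<in> path_image (polyline xs) \<Longrightarrow>
   \<exists>a\<in>set xs. \<exists>b\<in>set xs. adj2 a b \<and> z \<in> closed_segment (pt a) (pt b)"
proof (induction xs rule: polyline.induct)
  case (2 a)
  then show ?case by (auto simp: adj2_def)
next
  case (3 a b xs)
  have "pathfinish (linepath (pt a) (pt b)) = pathstart (polyline (b # xs))"
    using polyline_path[of "b # xs"] by simp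
  then have "z \<in> closed_segment (pt a) (pt b) \<or> z \<in> path_image (polyline (b # xs))"
    using "3.prems" by (simp add: path_image_join)
  then show ?case
  proof
    assume "z \<in> closed_segment (pt a) (pt b)"
    then show ?thesis using "3.prems" by auto
  next
    assume "z \<in> path_image (polyline (b # xs))"
    then show ?thesis using 3 by auto
  qed
qed auto

text \<open>Hence an intersection point of two polygonal lattice paths yields a common lattice point.\<close>
lemma floor_segment:
  assumes "adj2 a b" "z \<in> closed_segment (pt a) (pt b)"
  shows "(\<lfloor>z $ 1\<rfloor>, \<lfloor>z $ 2\<rfloor>) \<in> {a, b}"
proof -
  obtain u where u: "0 \<le> u" "u \<le> 1" "z = (1 - u) *\<^sub>R pt a + u *\<^sub>R pt b"
    using assms(2) by (auto simp: closed_segment_def)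
  obtain a1 a2 b1 b2 where ab: "a = (a1, a2)" "b = (b1, b2)" by (metis surj_pair)
  have z: "z $ 1 = a1 + u * (b1 - a1)" "z $ 2 = a2 + u * (b2 - a2)"
    unfolding u(3) ab by (simp_all add: algebra_simps)
  \<comment> \<open>Along a unit step the rounded coordinate changes only on arrival if the step
    goes up, and immediately after departure if it goes down.\<close>
  have key: "\<lfloor>real_of_int c + u * real_of_int d\<rfloor> = (if d = 1 \<and> u = 1 \<or> d = -1 \<and> 0 < u then c + d else c)"
    if "d \<in> {-1, 0, 1}" for c d
    using that u(1,2) by (auto simp: floor_eq_iff)
  have d: "b1 - a1 \<in> {-1, 0, 1}" "b2 - a2 \<in> {-1, 0, 1}" "b1 = a1 \<or> b2 = a2"
    using assms(1) ab by (auto simp: adj2_def)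
  show ?thesis
    using key[OF d(1), of a1] key[OF d(2), of a2] d unfolding z ab by (auto split: if_splits)
qed

text \<open>\<open>fashoda\<close> yields a common point of the two polygonal curves. Rounding it
  down is the same operation for both lists and gives a vertex of each.\<close>

lemma crossing_lists_meet:
  assumes "\<alpha> \<noteq> []" "successively adj2 \<alpha>" "set \<alpha> \<subseteq> {l..r} \<times> {b..t}" "fst (hd \<alpha>) = l" "fst (last \<alpha>) = r"
    and "\<beta> \<noteq> []" "successively adj2 \<beta>" "set \<beta> \<subseteq> {l..r} \<times> {b..t}" "snd (hd \<beta>) = b" "snd (last \<beta>) = t"
  shows "set \<alpha> \<inter> set \<beta> \<noteq> {}"
proof -
  have box: "path_image (polyline xs) \<subseteq> cbox (pt (l, b)) (pt (r, t))"
    if xs: "xs \<noteq> []" "successively adj2 xs" "set xs \<subseteq> {l..r} \<times> {b..t}" for xs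
  proof
    fix z assume "z \<in> path_image (polyline xs)"
    then obtain c d where cd: "c \<in> set xs" "d \<in> set xs" "z \<in> closed_segment (pt c) (pt d)"
      using polyline_image[OF xs(1,2), of z] by blast
    have "pt c \<in> cbox (pt (l, b)) (pt (r, t))" "pt d \<in> cbox (pt (l, b)) (pt (r, t))"
      using cd(1,2) xs(3) by (auto simp: mem_box_cart forall_2)
    then show "z \<in> cbox (pt (l, b)) (pt (r, t))"
      using cd(3) closed_segment_subset[OF _ _ convex_box(1)] by blast
  qed
  obtain z where z: "z \<in> path_image (polyline \<alpha>)" "z \<in> path_image (polyline \<beta>)"
  proof (rule fashoda)
    show "path_image (polyline \<alpha>) \<subseteq> cbox (pt (l, b)) (pt (r, t))" "path_image (polyline \<beta>) \<subseteq> cbox (pt (l, b)) (pt (r, t))"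
      using box assms by auto
  qed (use polyline_path[of \<alpha>] polyline_path[of \<beta>] assms in auto)
  have "(\<lfloor>z $ 1\<rfloor>, \<lfloor>z $ 2\<rfloor>) \<in> set \<alpha>" "(\<lfloor>z $ 1\<rfloor>, \<lfloor>z $ 2\<rfloor>) \<in> set \<beta>"
    using polyline_image[OF assms(1,2) z(1)] polyline_image[OF assms(6,7) z(2)] floor_segment[of _ _ z] by blast+
  then show ?thesis by blast
qed


section \<open>Intersections forced by extending paths beyond a box\<close>

definition lat :: "(int \<times> int) list \<Rightarrow> int \<times> int \<Rightarrow> int \<times> int \<Rightarrow> bool" where
  "lat xs u v \<longleftrightarrow> xs \<noteq> [] \<and> successively adj2 xs \<and> hd xs = u \<and> last xs = v"

lemma adj2_sym: "adj2 a b \<Longrightarrow> adj2 b a"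
  by (auto simp: adj2_def)

lemma lat_rev: "lat xs u v \<Longrightarrow> lat (rev xs) v u"
  by (auto simp: lat_def hd_rev last_rev intro: successively_mono adj2_sym)

lemma lat_append: "lat xs u v \<Longrightarrow> lat ys v' w \<Longrightarrow> adj2 v v' \<Longrightarrow> lat (xs @ ys) u w"
  by (auto simp: lat_def successively_append_iff)

lemma lat_hline: "a \<le> b \<Longrightarrow> \<exists>xs. lat xs (a, y) (b, y) \<and> set xs = {a..b} \<times> {y}"
proof (induction b rule: int_ge_induct)
  case base
  then show ?case by (intro exI[of _ "[(a, y)]"]) (auto simp: lat_def)
next
  case (step b)
  then obtain xs where "lat xs (a, y) (b, y)" "set xs = {a..b} \<times> {y}" by auto
  moreover have "{a..b + 1} = insert (b + 1) {a..b}" using step.hyps by auto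
  ultimately show ?case
    by (intro exI[of _ "xs @ [(b + 1, y)]"]) (auto simp: lat_def successively_append_iff adj2_def)
qed

lemma lat_vline: "a \<le> b \<Longrightarrow> \<exists>xs. lat xs (x, a) (x, b) \<and> set xs = {x} \<times> {a..b}"
proof (induction b rule: int_ge_induct)
  case base
  then show ?case by (intro exI[of _ "[(x, a)]"]) (auto simp: lat_def)
next
  case (step b)
  then obtain xs where "lat xs (x, a) (x, b)" "set xs = {x} \<times> {a..b}" by auto
  moreover have "{a..b + 1} = insert (b + 1) {a..b}" using step.hyps by auto
  ultimately show ?case
    by (intro exI[of _ "xs @ [(x, b + 1)]"]) (auto simp: lat_def successively_append_iff adj2_def)
qed

lemma lat_crossings_meet:
  assumes "lat \<alpha> (l, y1) (r, y2)" "set \<alpha> \<subseteq> {l..r} \<times> {b..t}"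
    and "lat \<beta> (x1, b) (x2, t)" "set \<beta> \<subseteq> {l..r} \<times> {b..t}"
  shows "set \<alpha> \<inter> set \<beta> \<noteq> {}"
  by (rule crossing_lists_meet[of \<alpha> l r b t \<beta>]) (use assms in \<open>simp_all add: lat_def\<close>)

lemma lat_ends_in: "lat xs u v \<Longrightarrow> u \<in> set xs" "lat xs u v \<Longrightarrow> v \<in> set xs"
  by (auto simp: lat_def)

text \<open>Below the box, \<open>\<alpha>\<close> is extended from \<open>j\<close> along row -1 to
  the new right side \<open>r + 1\<close>; \<open>\<beta>\<close> is extended down at
  \<open>i\<close> and up along column \<open>r + 1\<close>. This gives a horizontal and a vertical
  crossing of a larger box. As \<open>i < j\<close>, the added pieces are disjoint, so the meeting
  point is on the original paths.\<close>

lemma left_right_meet: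
  assumes \<alpha>: "lat \<alpha> (j, 0) (l, y1)" "set \<alpha> \<subseteq> {l..r} \<times> {0..t}"
    and \<beta>: "lat \<beta> (i, 0) (r, y2)" "set \<beta> \<subseteq> {l..r} \<times> {0..t}" and ij: "i < j"
  shows "set \<alpha> \<inter> set \<beta> \<noteq> {}"
proof -
  have rng: "l \<le> i" "j \<le> r" "0 \<le> y2" "y2 \<le> t" using lat_ends_in[OF \<alpha>(1)] lat_ends_in[OF \<beta>(1)] \<alpha>(2) \<beta>(2) by auto
  obtain a where a: "lat a (j, -1) (r + 1, -1)" "set a = {j..r+1} \<times> {-1}"
    using lat_hline[of j "r + 1" "-1"] rng by auto
  obtain b where b: "lat b (i, -2) (i, -1)" "set b = {i} \<times> {-2..-1}"
    using lat_vline[of "-2" "-1" i] by auto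
  obtain c where c: "lat c (r + 1, y2) (r + 1, t)" "set c = {r + 1} \<times> {y2..t}"
    using lat_vline[of y2 t "r + 1"] rng by auto
  have H1: "lat (rev \<alpha> @ a) (l, y1) (r + 1, -1)"
    by (rule lat_append[OF lat_rev[OF \<alpha>(1)] a(1)]) (auto simp: adj2_def)
  have H2: "lat (b @ \<beta> @ c) (i, -2) (r + 1, t)"
    by (rule lat_append[OF b(1) lat_append[OF \<beta>(1) c(1)]]) (auto simp: adj2_def)
  have "set (rev \<alpha> @ a) \<inter> set (b @ \<beta> @ c) \<noteq> {}"
    by (rule lat_crossings_meet[OF H1 _ H2]) (use \<alpha> \<beta> a b c rng ij in auto)
  then show ?thesis using \<alpha>(2) \<beta>(2) a(2) b(2) c(2) ij rng by auto
qed

text \<open>Here \<open>\<alpha>\<close> is extended from \<open>i\<close> to the left side along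
  row -1 and \<open>\<beta>\<close> downwards at \<open>j\<close>; \<open>i < j\<close> keeps the
  additions apart.\<close>

lemma right_top_meet:
  assumes \<alpha>: "lat \<alpha> (i, 0) (r, y1)" "set \<alpha> \<subseteq> {l..r} \<times> {0..t}"
    and \<beta>: "lat \<beta> (j, 0) (x2, t)" "set \<beta> \<subseteq> {l..r} \<times> {0..t}" and ij: "i < j"
  shows "set \<alpha> \<inter> set \<beta> \<noteq> {}"
proof -
  have rng: "l \<le> i" "j \<le> r" "0 \<le> t" using lat_ends_in[OF \<alpha>(1)] lat_ends_in[OF \<beta>(1)] \<alpha>(2) \<beta>(2) by auto
  obtain a where a: "lat a (l, -1) (i, -1)" "set a = {l..i} \<times> {-1}"
    using lat_hline[of l i "-1"] rng by auto
  obtain b where b: "lat b (j, -2) (j, -1)" "set b = {j} \<times> {-2..-1}"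
    using lat_vline[of "-2" "-1" j] by auto
  have H1: "lat (a @ \<alpha>) (l, -1) (r, y1)"
    by (rule lat_append[OF a(1) \<alpha>(1)]) (auto simp: adj2_def)
  have H2: "lat (b @ \<beta>) (j, -2) (x2, t)"
    by (rule lat_append[OF b(1) \<beta>(1)]) (auto simp: adj2_def)
  have "set (a @ \<alpha>) \<inter> set (b @ \<beta>) \<noteq> {}"
    by (rule lat_crossings_meet[OF H1 _ H2]) (use \<alpha> \<beta> a b rng ij in auto)
  then show ?thesis using \<alpha>(2) \<beta>(2) a(2) b(2) ij rng by auto
qed

text \<open>Three rows below the box are used. \<open>\<alpha>\<close> comes from the left in row -1
  and leaves to the right in row -2; \<open>\<beta>\<close> comes up from row -3 and leaves in row
  -1, then up along column \<open>r + 1\<close>. The interlacing order of the feet makes these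
  additions disjoint.\<close>

lemma arches_meet:
  assumes \<alpha>: "lat \<alpha> (s1, 0) (s3, 0)" "set \<alpha> \<subseteq> {l..r} \<times> {0..t}"
    and \<beta>: "lat \<beta> (s2, 0) (s4, 0)" "set \<beta> \<subseteq> {l..r} \<times> {0..t}"
    and s: "s1 < s2" "s2 < s3" "s3 < s4"
  shows "set \<alpha> \<inter> set \<beta> \<noteq> {}"
proof -
  have rng: "l \<le> s1" "s4 \<le> r" "0 \<le> t" using lat_ends_in[OF \<alpha>(1)] lat_ends_in[OF \<beta>(1)] \<alpha>(2) \<beta>(2) by auto
  obtain a where a: "lat a (l, -1) (s1, -1)" "set a = {l..s1} \<times> {-1}"
    using lat_hline[of l s1 "-1"] rng by auto
  obtain a' where a': "lat a' (s3, -2) (s3, -1)" "set a' = {s3} \<times> {-2..-1}"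
    using lat_vline[of "-2" "-1" s3] by auto
  obtain a'' where a'': "lat a'' (s3, -2) (r + 1, -2)" "set a'' = {s3..r + 1} \<times> {-2}"
    using lat_hline[of s3 "r + 1" "-2"] rng s by auto
  obtain b where b: "lat b (s2, -3) (s2, -1)" "set b = {s2} \<times> {-3..-1}"
    using lat_vline[of "-3" "-1" s2] by auto
  obtain b' where b': "lat b' (s4, -1) (r + 1, -1)" "set b' = {s4..r + 1} \<times> {-1}"
    using lat_hline[of s4 "r + 1" "-1"] rng by auto
  obtain c where c: "lat c (r + 1, -1) (r + 1, t)" "set c = {r + 1} \<times> {-1..t}"
    using lat_vline[of "-1" t "r + 1"] rng by auto
  have H1: "lat (a @ \<alpha> @ rev a' @ a'') (l, -1) (r + 1, -2)"
    by (rule lat_append[OF a(1) lat_append[OF \<alpha>(1) lat_append[OF lat_rev[OF a'(1)] a''(1)]]]) (auto simp: adj2_def)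
  have H2: "lat (b @ \<beta> @ b' @ c) (s2, -3) (r + 1, t)"
    by (rule lat_append[OF b(1) lat_append[OF \<beta>(1) lat_append[OF b'(1) c(1)]]]) (auto simp: adj2_def)
  have "set (a @ \<alpha> @ rev a' @ a'') \<subseteq> {l..r + 1} \<times> {-3..t}"
    using \<alpha>(2) rng s unfolding set_append set_rev a(2) a'(2) a''(2) by (intro Un_least) auto
  moreover have "set (b @ \<beta> @ b' @ c) \<subseteq> {l..r + 1} \<times> {-3..t}"
    using \<beta>(2) rng s unfolding set_append b(2) b'(2) c(2) by (intro Un_least) auto
  ultimately have "set (a @ \<alpha> @ rev a' @ a'') \<inter> set (b @ \<beta> @ b' @ c) \<noteq> {}"
    by (rule lat_crossings_meet[OF H1 _ H2])
  then obtain x y where "(x, y) \<in> set (a @ \<alpha> @ rev a' @ a'')" "(x, y) \<in> set (b @ \<beta> @ b' @ c)"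
    by auto
  then have "l \<le> x \<and> x \<le> s1 \<and> y = -1 \<or> (x, y) \<in> set \<alpha> \<or> x = s3 \<and> -2 \<le> y \<and> y \<le> -1 \<or> s3 \<le> x \<and> x \<le> r + 1 \<and> y = -2"
    and "x = s2 \<and> -3 \<le> y \<and> y \<le> -1 \<or> (x, y) \<in> set \<beta> \<or> s4 \<le> x \<and> x \<le> r + 1 \<and> y = -1 \<or> x = r + 1 \<and> -1 \<le> y \<and> y \<le> t"
    unfolding set_append set_rev a(2) a'(2) a''(2) b(2) b'(2) c(2) by simp_all
  moreover have "(x, y) \<in> set \<alpha> \<Longrightarrow> x \<le> r \<and> 0 \<le> y" "(x, y) \<in> set \<beta> \<Longrightarrow> x \<le> r \<and> 0 \<le> y"
    using \<alpha>(2) \<beta>(2) by auto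
  ultimately have "(x, y) \<in> set \<alpha> \<and> (x, y) \<in> set \<beta>" using s rng by (elim disjE) auto
  then show ?thesis by blast
qed

section \<open>Crossing probabilities of boxes\<close>

lemma stp_restrict: "S \<subseteq> edges_on V \<Longrightarrow> stp (S \<inter> edges_on R) R = stp S R"
  unfolding stp_def using edges_onD edges_onI by blast

lemma conn_restrict_edges: "S \<subseteq> edges_on V \<Longrightarrow> conn (S \<inter> edges_on R) R A B = conn S R A B"
  unfolding conn_def by (simp add: stp_restrict)

lemma conn_mono':
  assumes "conn S W A B" "W \<subseteq> W'" "A \<inter> W \<subseteq> A'" "B \<inter> W \<subseteq> B'"
  shows "conn S W' A' B'"
proof -
  obtain a b where ab: "a \<in> A" "a \<in> W" "b \<in> B" "(a, b) \<in> (stp S W)\<^sup>*" using assms(1) by (auto simp: conn_def)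
  then have "b \<in> W" using stp_rtrancl_in by metis
  moreover have "(a, b) \<in> (stp S W')\<^sup>*" using stp_rtrancl_mono[OF order_refl assms(2) ab(4)] .
  ultimately show ?thesis using ab assms unfolding conn_def by blast
qed

lemma conn_subcrossing:
  fixes h :: "vertex \<Rightarrow> int"
  assumes "(u, v) \<in> (stp S W)\<^sup>*" "u \<in> W" "h u \<le> a" "b \<le> h v" "a \<le> b"
    and step: "\<And>x y. {x, y} \<in> S \<Longrightarrow> \<bar>h x - h y\<bar> \<le> 1"
  shows "conn S (W \<inter> {v. a \<le> h v \<and> h v \<le> b}) {v. h v = a} {v. h v = b}" (is "conn S ?W ?A ?B")
proof -
  define R where "R v \<longleftrightarrow> v \<in> ?W \<and> (\<exists>w\<in>?W. h w = a \<and> (w, v) \<in> (stp S ?W)\<^sup>*)" for v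
  have fini: "conn S ?W ?A ?B" if "R v" "h v = b" for v
    using that unfolding R_def conn_def by blast
  \<comment> \<open>Invariant along the walk: the current vertex is below the strip, or it is joined
    to the lower level inside the strip, or a crossing of the strip has been found.\<close>
  have "h v < a \<or> R v \<or> conn S ?W ?A ?B"
    using assms(1)
  proof (induction rule: rtrancl_induct)
    case base
    have "R u" if "h u = a" using that assms(2,5) unfolding R_def by auto
    then show ?case using assms(3) by fastforce
  next
    case (step c d)
    have cd: "c \<in> W" "d \<in> W" "{c, d} \<in> S" using step.hyps by (auto simp: stp_def)
    have hh: "\<bar>h c - h d\<bar> \<le> 1" using assms(6)[OF cd(3)] .
    from step.IH consider "h c < a" | "R c" "h c < b" | "conn S ?W ?A ?B"
      using fini unfolding R_def by fastforce
    then show ?case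
    proof cases
      case 1
      then have "h d < a \<or> h d = a" using hh by linarith
      moreover have "R d" if "h d = a" using that cd assms(5) unfolding R_def by auto
      ultimately show ?thesis by blast
    next
      case 2
      show ?thesis
      proof (cases "h d < a")
        case False
        then have "d \<in> ?W" using cd hh 2(2) by auto
        moreover have "(c, d) \<in> stp S ?W" using 2(1) \<open>d \<in> ?W\<close> cd(3) unfolding R_def stp_def by auto
        ultimately have "R d" using 2(1) unfolding R_def by (meson rtrancl_into_rtrancl)
        then show ?thesis by simp
      qed simp
    qed simp
  qed
  moreover have "h v = b" if "R v" using that assms(4) unfolding R_def by auto
  ultimately show ?thesis using fini[of v] assms(4,5) by linarith
qed

lemma finite_box [simp]: "finite (box k a b c d)"
proof -
  have "box k a b c d \<subseteq> {a..b} \<times> {c..d} \<times> {0..int k}" by (auto simp: box_def)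
  then show ?thesis by (rule finite_subset) auto
qed

lemma box_slab: "box k a b c d \<subseteq> slab k"
  by (auto simp: box_def slab_def)

lemma colfull_box [simp]: "colfull k (box k a b c d)"
  by (auto simp: colfull_def box_def slab_def)

lemma in_box [simp]: "(x, y, z) \<in> box k a b c d \<longleftrightarrow> a \<le> x \<and> x \<le> b \<and> c \<le> y \<and> y \<le> d \<and> 0 \<le> z \<and> z \<le> int k"
  by (auto simp: box_def)

lemma box_mono: "a' \<le> a \<Longrightarrow> b \<le> b' \<Longrightarrow> c' \<le> c \<Longrightarrow> d \<le> d' \<Longrightarrow> box k a b c d \<subseteq> box k a' b' c' d'"
  by (auto simp: box_def)

section \<open>Symmetries of the slab and probabilities of connections\<close>

definition shift :: "int \<Rightarrow> int \<Rightarrow> vertex \<Rightarrow> vertex" where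
  "shift d e v = (case v of (x, y, z) \<Rightarrow> (x + d, y + e, z))"

definition refl_x :: "int \<Rightarrow> vertex \<Rightarrow> vertex" where
  "refl_x c v = (case v of (x, y, z) \<Rightarrow> (c - x, y, z))"

definition swap_xy :: "vertex \<Rightarrow> vertex" where
  "swap_xy v = (case v of (x, y, z) \<Rightarrow> (y, x, z))"

lemma shift_box: "shift d e ` box k a b c d' = box k (a + d) (b + d) (c + e) (d' + e)"
proof (intro set_eqI iffI)
  fix v assume "v \<in> box k (a + d) (b + d) (c + e) (d' + e)"
  then show "v \<in> shift d e ` box k a b c d'"
    by (intro image_eqI[of _ _ "shift (-d) (-e) v"]) (auto simp: shift_def split: prod.splits)
qed (auto simp: shift_def)

lemma refl_x_box: "refl_x t ` box k a b c d = box k (t - b) (t - a) c d"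
proof (intro set_eqI iffI)
  fix v assume "v \<in> box k (t - b) (t - a) c d"
  then show "v \<in> refl_x t ` box k a b c d"
    by (intro image_eqI[of _ _ "refl_x t v"]) (auto simp: refl_x_def split: prod.splits)
qed (auto simp: refl_x_def)

lemma swap_xy_box: "swap_xy ` box k a b c d = box k c d a b"
proof (intro set_eqI iffI)
  fix v assume "v \<in> box k c d a b"
  then show "v \<in> swap_xy ` box k a b c d"
    by (intro image_eqI[of _ _ "swap_xy v"]) (auto simp: swap_xy_def split: prod.splits)
qed (auto simp: swap_xy_def)

locale slab_perc = bernoulli +
  fixes k :: nat
begin

definition P :: "vertex set \<Rightarrow> vertex set \<Rightarrow> vertex set \<Rightarrow> real" where
  "P R A B = pr (edges_on R) (\<lambda>S. conn S R A B)"

lemma P_eq: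
  assumes "finite V" "R \<subseteq> V"
  shows "pr (edges_on V) (\<lambda>S. conn S R A B) = P R A B"
  unfolding P_def
proof (rule pr_marginal)
  show "conn S R A B = conn (S \<inter> edges_on R) R A B" if "S \<subseteq> edges_on V" for S
    by (rule conn_restrict_edges[OF that, symmetric])
qed (rule finite_edges_on[OF assms(1)], rule edges_on_mono[OF assms(2)])

lemma P_nonneg [simp]: "0 \<le> P R A B"
  by (simp add: P_def)

lemma P_mono:
  assumes "finite R'" "R \<subseteq> R'" "A \<inter> R \<subseteq> A'" "B \<inter> R \<subseteq> B'"
  shows "P R A B \<le> P R' A' B'"
proof -
  have "P R A B = pr (edges_on R') (\<lambda>S. conn S R A B)" using assms by (simp add: P_eq)
  also have "\<dots> \<le> P R' A' B'" unfolding P_def using assms by (intro pr_mono) (auto elim: conn_mono')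
  finally show ?thesis .
qed

lemma P_commute: "P R A B = P R B A"
  unfolding P_def by (simp add: conn_commute)

lemma stp_image: "(a, b) \<in> (stp S R)\<^sup>* \<Longrightarrow> (\<phi> a, \<phi> b) \<in> (stp ((`) \<phi> ` S) (\<phi> ` R))\<^sup>*"
proof (induction rule: rtrancl_induct)
  case (step b c)
  then have "(\<phi> b, \<phi> c) \<in> stp ((`) \<phi> ` S) (\<phi> ` R)"
    by (auto simp: stp_def intro!: image_eqI[of _ _ "{b, c}"])
  then show ?case using step.IH by simp
qed simp

lemma conn_image: "conn S R A B \<Longrightarrow> conn ((`) \<phi> ` S) (\<phi> ` R) (\<phi> ` A) (\<phi> ` B)"
  unfolding conn_def using stp_image[of _ _ S R \<phi>] by (meson IntE IntI imageI)

lemma P_image: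
  assumes "finite R" "\<And>v. \<psi> (\<phi> v) = v" "\<And>u v. nn (\<phi> u) (\<phi> v) = nn u v"
  shows "P (\<phi> ` R) (\<phi> ` A) (\<phi> ` B) = P R A B"
proof -
  have inj: "inj \<phi>" using assms(2) by (metis injI)
  have E: "edges_on (\<phi> ` R) = (`) \<phi> ` edges_on R"
  proof
    show "edges_on (\<phi> ` R) \<subseteq> (`) \<phi> ` edges_on R"
    proof
      fix e assume "e \<in> edges_on (\<phi> ` R)"
      then obtain u v where "u \<in> R" "v \<in> R" "e = {\<phi> u, \<phi> v}" "nn (\<phi> u) (\<phi> v)"
        unfolding edges_on_def by blast
      then show "e \<in> (`) \<phi> ` edges_on R" using assms(3) by (auto intro!: image_eqI[of _ _ "{u, v}"] edges_onI)
    qed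
    show "(`) \<phi> ` edges_on R \<subseteq> edges_on (\<phi> ` R)"
      using assms(3) unfolding edges_on_def by blast
  qed
  have "conn ((`) \<phi> ` S) (\<phi> ` R) (\<phi> ` A) (\<phi> ` B) = conn S R A B" for S
  proof
    assume "conn ((`) \<phi> ` S) (\<phi> ` R) (\<phi> ` A) (\<phi> ` B)"
    then have "conn ((`) \<psi> ` (`) \<phi> ` S) (\<psi> ` \<phi> ` R) (\<psi> ` \<phi> ` A) (\<psi> ` \<phi> ` B)" by (rule conn_image)
    then show "conn S R A B" by (simp add: image_image assms(2))
  qed (rule conn_image)
  moreover have "inj_on ((`) \<phi>) (edges_on R)"
    using inj by (auto intro!: inj_onI simp: inj_image_eq_iff)
  ultimately show ?thesis
    unfolding P_def pr_def E using assms(1) by (simp add: ex_image finite_edges_on)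
qed

lemma P_shift: "finite R \<Longrightarrow> P (shift d e ` R) (shift d e ` A) (shift d e ` B) = P R A B"
  by (rule P_image[of _ "shift (-d) (-e)"]) (auto simp: shift_def nn_def split: prod.splits)

lemma P_refl_x: "finite R \<Longrightarrow> P (refl_x t ` R) (refl_x t ` A) (refl_x t ` B) = P R A B"
proof (rule P_image[of _ "refl_x t"])
  show "nn (refl_x t u) (refl_x t v) = nn u v" for u v
  proof -
    have "\<bar>t - a - (t - b)\<bar> = \<bar>a - b\<bar>" for a b by linarith
    then show ?thesis by (auto simp: refl_x_def nn_def split: prod.splits)
  qed
qed (auto simp: refl_x_def split: prod.splits)

lemma P_swap_xy: "finite R \<Longrightarrow> P (swap_xy ` R) (swap_xy ` A) (swap_xy ` B) = P R A B"
  by (rule P_image[of _ "swap_xy"]) (auto simp: swap_xy_def nn_def algebra_simps split: prod.splits)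

text \<open>The finite-volume form of \<open>f\<close>; the two agree by
  \<open>f_eq_X\<close>.\<close>

definition X :: "nat \<Rightarrow> nat \<Rightarrow> real" where
  "X m n = P (box k 0 (int m) 0 (int n)) (box k 0 0 0 (int n)) (box k (int m) (int m) 0 (int n))"

lemma X_horizontal:
  assumes "b = a + int m" "d = c + int n"
  shows "P (box k a b c d) (box k a a c d) (box k b b c d) = X m n"
  using P_shift[of "box k 0 (int m) 0 (int n)" a c "box k 0 0 0 (int n)" "box k (int m) (int m) 0 (int n)"]
  unfolding shift_box X_def assms by (simp add: add.commute)

lemma X_vertical:
  assumes "b = a + int n" "d = c + int m"
  shows "P (box k a b c d) (box k a b c c) (box k a b d d) = X m n"
  using P_swap_xy[of "box k c d a b" "box k c c a b" "box k d d a b"] X_horizontal[OF assms(2,1)]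
  unfolding swap_xy_box by simp

lemma X_mono: "n \<le> n' \<Longrightarrow> X m n \<le> X m n'"
  unfolding X_def by (intro P_mono finite_box) (auto simp: box_def)

lemma abs_nn:
  assumes "S \<subseteq> edges_on V" "{u, v} \<in> S"
  shows "\<bar>fst u - fst v\<bar> \<le> 1" "\<bar>fst (snd u) - fst (snd v)\<bar> \<le> 1"
proof -
  have "nn u v" using assms edges_onD by blast
  then show "\<bar>fst u - fst v\<bar> \<le> 1" "\<bar>fst (snd u) - fst (snd v)\<bar> \<le> 1"
    by (cases u; cases v; simp add: nn_def)+
qed

lemma P_subcrossing:
  assumes "A \<inter> R \<subseteq> {v. fst v \<le> a}" "B \<inter> R \<subseteq> {v. b \<le> fst v}" "R \<subseteq> box k l r 0 (int n)"
    and "b = a + int m"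
  shows "P R A B \<le> X m n"
proof -
  have fin: "finite R" by (rule finite_subset[OF assms(3) finite_box])
  let ?R = "R \<inter> {v. a \<le> fst v \<and> fst v \<le> b}"
  have "P R A B \<le> pr (edges_on R) (\<lambda>S. conn S ?R {v. fst v = a} {v. fst v = b})"
    unfolding P_def
  proof (rule pr_mono)
    fix S assume S: "S \<subseteq> edges_on R" "conn S R A B"
    then obtain u v where "u \<in> A" "u \<in> R" "v \<in> B" "(u, v) \<in> (stp S R)\<^sup>*" by (auto simp: conn_def)
    moreover from this have "v \<in> R" using stp_rtrancl_in by metis
    ultimately show "conn S ?R {v. fst v = a} {v. fst v = b}"
      using assms(1,2,4) abs_nn(1)[OF S(1)] by (intro conn_subcrossing[of u v S R fst a b]) auto
  qed
  also have "\<dots> = P ?R {v. fst v = a} {v. fst v = b}" using fin by (intro P_eq) auto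
  also have "\<dots> \<le> P (box k a b 0 (int n)) (box k a a 0 (int n)) (box k b b 0 (int n))"
    using assms(3) by (intro P_mono finite_box) (auto simp: box_def)
  also have "\<dots> = X m n" using assms(4) by (intro X_horizontal) auto
  finally show ?thesis .
qed

lemma X_antimono: "m \<le> m' \<Longrightarrow> X m' n \<le> X m n"
  unfolding X_def[of m' n]
  by (rule P_subcrossing[of _ _ 0 _ "int m" 0 "int m'"]) (auto simp: box_def)

text \<open>Compare the vertical extent of a crossing with \<open>7 * d\<close>. If it is at most
  that, the crossing fits into a window of height \<open>8 * d\<close> at a multiple of
  \<open>d\<close>, since rounding down the lowest level costs at most \<open>d\<close>. Otherwise
  rounding that level up leaves a vertical crossing of a square of side \<open>6 * d\<close>. There
  are 13 positions with two alternatives each, hence 26.\<close>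

lemma X_near_square:
  assumes "1 \<le> e"
  shows "X (6 * e) (12 * e) \<le> 26 * X (6 * e) (8 * e)"
proof -
  define d where "d = int e"
  have d: "1 \<le> d" using assms by (simp add: d_def)
  \<comment> \<open>Windows start at heights up to \<open>12 * d\<close> and may stick out of
    \<open>?V\<close>; \<open>?U\<close> is tall enough to contain them all.\<close>
  let ?V = "box k 0 (6 * d) 0 (12 * d)" and ?U = "box k 0 (6 * d) 0 (24 * d)"
  let ?H = "\<lambda>i S. conn S (box k 0 (6 * d) (i * d) (i * d + 8 * d)) (box k 0 0 (i * d) (i * d + 8 * d))
    (box k (6 * d) (6 * d) (i * d) (i * d + 8 * d))"
  let ?T = "\<lambda>i S. conn S (box k 0 (6 * d) (i * d) (i * d + 6 * d)) (box k 0 (6 * d) (i * d) (i * d))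
    (box k 0 (6 * d) (i * d + 6 * d) (i * d + 6 * d))"
  let ?I = "{0..12 :: int}"
  have "X (6 * e) (12 * e) = pr (edges_on ?U) (\<lambda>S. conn S ?V (box k 0 0 0 (12 * d)) (box k (6 * d) (6 * d) 0 (12 * d)))"
    unfolding X_def using d by (subst P_eq) (simp_all add: d_def box_mono)
  also have "\<dots> \<le> (\<Sum>i\<in>?I. pr (edges_on ?U) (\<lambda>S. ?H i S \<or> ?T i S))"
  proof (rule pr_union)
    fix S assume S: "S \<subseteq> edges_on ?U" "conn S ?V (box k 0 0 0 (12 * d)) (box k (6 * d) (6 * d) 0 (12 * d))"
    then obtain xs where xs: "walk S ?V xs" "hd xs \<in> box k 0 0 0 (12 * d)" "last xs \<in> box k (6 * d) (6 * d) 0 (12 * d)"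
      unfolding conn_iff_paths paths_def by auto
    let ?y = "\<lambda>v :: vertex. fst (snd v)"
    have ne: "xs \<noteq> []" "set xs \<subseteq> ?V" using xs(1) by (auto simp: walk_def)
    have yf: "finite (?y ` set xs)" "?y ` set xs \<noteq> {}" using ne by auto
    obtain u where u: "u \<in> set xs" "?y u = Min (?y ` set xs)" using imageE[OF Min_in[OF yf]] by metis
    obtain v where v: "v \<in> set xs" "?y v = Max (?y ` set xs)" using imageE[OF Max_in[OF yf]] by metis
    have bnd: "?y u \<le> ?y w \<and> ?y w \<le> ?y v" if "w \<in> set xs" for w
      unfolding u(2) v(2) using that yf(1) by simp
    have uv: "0 \<le> ?y u" "?y v \<le> 12 * d" "?y u \<le> ?y v" using subsetD[OF ne(2) u(1)] subsetD[OF ne(2) v(1)] bnd[OF u(1)] by (auto simp: box_def)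
    define q where "q = ?y u div d"
    have q: "q * d \<le> ?y u" "?y u < q * d + d" "0 \<le> q"
    proof -
      have "q * d + ?y u mod d = ?y u" by (simp add: q_def)
      moreover have "0 \<le> ?y u mod d" "?y u mod d < d" using d by auto
      ultimately show "q * d \<le> ?y u" "?y u < q * d + d" by linarith+
      show "0 \<le> q" using uv(1) d by (simp add: q_def pos_imp_zdiv_nonneg_iff)
    qed
    show "\<exists>i\<in>?I. ?H i S \<or> ?T i S"
    proof (cases "?y v - ?y u \<le> 7 * d")
      case True
      have "q * d \<le> 12 * d" using q uv by linarith
      then have "q \<in> ?I" using q d by simp
      have sub: "set xs \<subseteq> box k 0 (6 * d) (q * d) (q * d + 8 * d)"
      proof
        fix w assume w: "w \<in> set xs"
        then have "w \<in> ?V" using ne(2) by blast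
        then show "w \<in> box k 0 (6 * d) (q * d) (q * d + 8 * d)"
          using bnd[OF w] q True by (cases w) simp
      qed
      have "walk S (box k 0 (6 * d) (q * d) (q * d + 8 * d)) xs" using xs(1) by (rule walk_change) (use sub in auto)
      moreover have "hd xs \<in> box k 0 (6 * d) (q * d) (q * d + 8 * d)" "last xs \<in> box k 0 (6 * d) (q * d) (q * d + 8 * d)"
        using sub ne hd_in_set last_in_set by blast+
      then have "hd xs \<in> box k 0 0 (q * d) (q * d + 8 * d)" "last xs \<in> box k (6 * d) (6 * d) (q * d) (q * d + 8 * d)"
        using xs(2,3) by (cases "hd xs"; cases "last xs"; simp)+
      ultimately have "?H q S"
        using ne hd_in_set last_in_set by (intro walk_cn[of _ _ xs "hd xs" _ "last xs"]) blast+
      then show ?thesis using \<open>q \<in> ?I\<close> by blast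
    next
      case False
      define i where "i = q + 1"
      have i: "?y u \<le> i * d" "i * d + 6 * d \<le> ?y v" using q False unfolding i_def by (auto simp: algebra_simps)
      have "i * d \<le> 12 * d" using i uv d by linarith
      then have "i \<in> ?I" using q d unfolding i_def by simp
      have "conn S (?V \<inter> {v. i * d \<le> ?y v \<and> ?y v \<le> i * d + 6 * d}) {v. ?y v = i * d} {v. ?y v = i * d + 6 * d}"
        using i d walk_rtrancl[OF xs(1) u(1) v(1)] u(1) ne abs_nn(2)[OF S(1)]
        by (intro conn_subcrossing[of u v S ?V ?y]) auto
      then have "?T i S" by (rule conn_mono') (auto simp: box_def)
      then show ?thesis using \<open>i \<in> ?I\<close> by blast
    qed
  qed simp
  also have "\<dots> \<le> (\<Sum>i\<in>?I. X (6 * e) (8 * e) + X (6 * e) (8 * e))"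
  proof (rule sum_mono)
    fix i assume i: "i \<in> ?I"
    have le: "0 \<le> i * d" "i * d \<le> 12 * d" using i d by auto
    have sub: "box k 0 (6 * d) (i * d) (i * d + 8 * d) \<subseteq> ?U" "box k 0 (6 * d) (i * d) (i * d + 6 * d) \<subseteq> ?U"
      using le d by (intro box_mono; linarith)+
    have "pr (edges_on ?U) (\<lambda>S. ?H i S \<or> ?T i S) \<le> pr (edges_on ?U) (?H i) + pr (edges_on ?U) (?T i)"
      by (rule pr_union2)
    also have "pr (edges_on ?U) (?H i) = X (6 * e) (8 * e)"
      unfolding P_eq[OF finite_box sub(1)] by (rule X_horizontal) (simp_all add: d_def)
    also have "pr (edges_on ?U) (?T i) = X (6 * e) (6 * e)"
      unfolding P_eq[OF finite_box sub(2)] by (rule X_vertical) (simp_all add: d_def)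
    also have "\<dots> \<le> X (6 * e) (8 * e)" by (intro X_mono) simp
    finally show "pr (edges_on ?U) (\<lambda>S. ?H i S \<or> ?T i S) \<le> X (6 * e) (8 * e) + X (6 * e) (8 * e)" by simp
  qed
  also have "\<dots> = 26 * X (6 * e) (8 * e)" by simp
  finally show ?thesis .
qed


lemma P_union:
  assumes "finite I" "A \<inter> R \<subseteq> (\<Union>i\<in>I. C i)"
  shows "P R A B \<le> (\<Sum>i\<in>I. P R (C i) B)"
  unfolding P_def
proof (rule pr_union[OF assms(1)])
  fix S assume "conn S R A B"
  then obtain a b where "a \<in> A" "a \<in> R" "b \<in> B" "(a, b) \<in> (stp S R)\<^sup>*" unfolding conn_def by blast
  moreover from this obtain i where "i \<in> I" "a \<in> C i" using assms(2) by blast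
  ultimately show "\<exists>i\<in>I. conn S R (C i) B" unfolding conn_def by blast
qed

text \<open>The bottom is the side \<open>y = 0\<close>, not height 0 of the slab: a segment
  consists of full columns.\<close>

definition seg :: "int \<Rightarrow> int \<Rightarrow> vertex set" where
  "seg d s = box k s (s + d) 0 0"

text \<open>The bottom of a box of half width \<open>48 * d\<close> is covered by 96 segments, and
  one of them has at least the average probability. A single index \<open>i\<close> serves all
  shifts \<open>c\<close>, because the larger box leaves a margin of \<open>6 * d\<close> on both
  sides.\<close>

lemma seg_to_top:
  assumes "1 \<le> e" and d: "d = int e"
  shows "\<exists>i\<in>{0..47}. \<forall>c. \<bar>c\<bar> \<le> 6 * d \<longrightarrow>
    X (72 * e) (96 * e) / 96 \<le> P (box k (-54 * d) (54 * d) 0 (72 * d)) (seg d (c + i * d)) (box k (-54 * d) (54 * d) (72 * d) (72 * d))"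
proof -
  have d1: "1 \<le> d" using assms by simp
  let ?U = "box k (-48 * d) (48 * d) 0 (72 * d)" and ?T = "box k (-48 * d) (48 * d) (72 * d) (72 * d)"
  let ?B = "box k (-48 * d) (48 * d) 0 0" and ?I = "{-48..47 :: int}"
  have "X (72 * e) (96 * e) = P ?U ?B ?T"
    using X_vertical[of "48 * d" "-48 * d" "96 * e" "72 * d" 0 "72 * e"] d by simp
  also have "\<dots> \<le> (\<Sum>i\<in>?I. P ?U (seg d (i * d)) ?T)"
  proof (rule P_union)
    show "?B \<inter> ?U \<subseteq> (\<Union>i\<in>?I. seg d (i * d))"
    proof
      fix v assume v: "v \<in> ?B \<inter> ?U"
      obtain x z where vx: "v = (x, 0, z)" "0 \<le> z" "z \<le> int k" "-48 * d \<le> x" "x \<le> 48 * d"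
        using v by (cases v) auto
      \<comment> \<open>The minimum assigns the right end \<open>x = 48 * d\<close> to the last
        segment.\<close>
      define i where "i = min 47 (x div d)"
      have m: "(x div d) * d + x mod d = x" "0 \<le> x mod d" "x mod d < d" using d1 by auto
      have "-48 \<le> x div d"
      proof (rule ccontr)
        assume "\<not> -48 \<le> x div d"
        then have "(x div d) * d \<le> -49 * d" using d1 by (intro mult_right_mono) auto
        then show False using m vx(4) by linarith
      qed
      then have "i \<in> ?I" by (simp add: i_def)
      moreover have "i * d \<le> x \<and> x \<le> i * d + d"
      proof (cases "x div d \<le> 47")
        case True
        then have "i = x div d" by (simp add: i_def)
        then show ?thesis unfolding \<open>i = x div d\<close> using m by (intro conjI) linarith+
      next
        case False
        then have "48 * d \<le> (x div d) * d" using d1 by (intro mult_right_mono) auto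
        then have "47 * d \<le> x" using m d1 by linarith
        then show ?thesis using False vx(5) by (simp add: i_def)
      qed
      ultimately show "v \<in> (\<Union>i\<in>?I. seg d (i * d))" using vx by (auto simp: seg_def)
    qed
  qed simp
  finally have "\<exists>i\<in>?I. X (72 * e) (96 * e) / 96 \<le> P ?U (seg d (i * d)) ?T"
    using sum_strict_mono[of ?I "\<lambda>i. P ?U (seg d (i * d)) ?T" "\<lambda>_. X (72 * e) (96 * e) / 96"] by force
  then obtain j where j: "j \<in> ?I" "X (72 * e) (96 * e) / 96 \<le> P ?U (seg d (j * d)) ?T" by blast
  have "P (refl_x 0 ` ?U) (refl_x 0 ` seg d (j * d)) (refl_x 0 ` ?T) = P ?U (seg d (j * d)) ?T"
    by (rule P_refl_x) simp
  then have mir: "P ?U (seg d ((- j - 1) * d)) ?T = P ?U (seg d (j * d)) ?T"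
  proof -
    have "refl_x 0 ` seg d (j * d) = seg d ((- j - 1) * d)"
      unfolding seg_def refl_x_box by (rule arg_cong2[of _ _ _ _ "\<lambda>a b. box k a b 0 0"]) (simp_all add: algebra_simps)
    then show ?thesis using \<open>P (refl_x 0 ` ?U) _ _ = _\<close> by (simp add: refl_x_box)
  qed
  \<comment> \<open>Segments \<open>j\<close> and \<open>- j - 1\<close> are mirror images, so the
    one in the right half may be chosen.\<close>
  define i where "i = (if 0 \<le> j then j else - j - 1)"
  have i: "i \<in> {0..47}" "X (72 * e) (96 * e) / 96 \<le> P ?U (seg d (i * d)) ?T"
    using j mir by (auto simp: i_def)
  have "X (72 * e) (96 * e) / 96 \<le>
    P (box k (-54 * d) (54 * d) 0 (72 * d)) (seg d (c + i * d)) (box k (-54 * d) (54 * d) (72 * d) (72 * d))"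
    if c: "\<bar>c\<bar> \<le> 6 * d" for c
  proof -
    note i(2)
    also have "P ?U (seg d (i * d)) ?T = P (shift c 0 ` ?U) (shift c 0 ` seg d (i * d)) (shift c 0 ` ?T)"
      by (rule P_shift[symmetric]) simp
    also have "\<dots> \<le> P (box k (-54 * d) (54 * d) 0 (72 * d)) (seg d (c + i * d)) (box k (-54 * d) (54 * d) (72 * d) (72 * d))"
      using c unfolding shift_box seg_def by (intro P_mono finite_box) (auto simp: box_def)
    finally show ?thesis .
  qed
  with i(1) show ?thesis by blast
qed

section \<open>Agreement with the infinite product measure\<close>

lemma f_eq_X: "f k p m n = X m n"
proof -
  define V where "V = box k 0 (int m) 0 (int n)"
  define L where "L = box k 0 0 0 (int n)"
  define R where "R = box k (int m) (int m) 0 (int n)"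
  define I where "I = edges_on (slab k)"
  define E where "E = edges_on V"
  define M where "M = (\<lambda>_ :: edge. measure_pmf (bernoulli_pmf p))"
  have EI: "E \<subseteq> I" "finite E" unfolding E_def I_def V_def
    using edges_on_mono[OF box_slab] finite_edges_on by auto
  interpret product_prob_space M I
    by (auto simp: M_def product_prob_space_def product_sigma_finite_def product_prob_space_axioms_def
        intro: prob_space_imp_sigma_finite prob_space_measure_pmf)
  have perc: "perc k p = PiM I M" by (simp add: perc_def I_def M_def)
  \<comment> \<open>The crossing event is a disjoint union of cylinders, each prescribing the set
    \<open>S\<close> of open edges in the finite set \<open>E\<close>; such a cylinder has measure
    \<open>wt E S\<close>.\<close>
  define cyl where "cyl S = prod_emb I M E (Pi\<^sub>E E (\<lambda>e. {e \<in> S}))" for S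
  have cyl: "cyl S = {\<omega> \<in> space (PiM I M). {e \<in> E. \<omega> e} = S}" if "S \<subseteq> E" for S
    using that unfolding cyl_def prod_emb_def space_PiM by (auto simp: PiE_iff M_def extensional_def)
  have mcyl: "measure (PiM I M) (cyl S) = wt E S" if "S \<subseteq> E" for S
  proof -
    have "measure (PiM I M) (cyl S) = (\<Prod>e\<in>E. measure (M e) {e \<in> S})"
      unfolding cyl_def using EI by (intro measure_PiM_emb) (auto simp: M_def)
    also have "\<dots> = wt E S"
      unfolding wt_def using p_pos p_less_1 by (intro prod.cong) (auto simp: M_def measure_pmf_single)
    finally show ?thesis .
  qed
  have conn: "open_conn \<omega> V u v \<longleftrightarrow> (u, v) \<in> (stp {e \<in> E. \<omega> e} V)\<^sup>*" for \<omega> u v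
  proof -
    have "stp {e \<in> E. \<omega> e} V = {(a,b). a \<in> V \<and> b \<in> V \<and> nn a b \<and> \<omega> {a,b}}"
      unfolding stp_def E_def using edges_onI edges_onD by blast
    then show ?thesis unfolding open_conn_def by simp
  qed
  have ev: "crossing_event k m n \<inter> space (PiM I M) = (\<Union>S\<in>{S. S \<subseteq> E \<and> conn S V L R}. cyl S)" (is "?l = ?r")
  proof (intro set_eqI)
    fix \<omega>
    have "L \<subseteq> V" by (auto simp: L_def V_def box_def)
    then have "\<omega> \<in> crossing_event k m n \<longleftrightarrow> conn {e \<in> E. \<omega> e} V L R"
      unfolding crossing_event_def conn_def V_def[symmetric] L_def[symmetric] R_def[symmetric]
      unfolding conn by blast
    moreover have "\<omega> \<in> ?r \<longleftrightarrow> \<omega> \<in> space (PiM I M) \<and> conn {e \<in> E. \<omega> e} V L R"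
    proof -
      have "\<omega> \<in> ?r \<longleftrightarrow> (\<exists>S. S \<subseteq> E \<and> conn S V L R \<and> \<omega> \<in> space (PiM I M) \<and> {e \<in> E. \<omega> e} = S)"
        using cyl by auto
      then show ?thesis by auto
    qed
    ultimately show "\<omega> \<in> ?l \<longleftrightarrow> \<omega> \<in> ?r" by blast
  qed
  have "f k p m n = (\<Sum>S\<in>{S. S \<subseteq> E \<and> conn S V L R}. measure (PiM I M) (cyl S))"
    unfolding f_def perc ev
  proof (rule finite_measure_finite_Union)
    show "disjoint_family_on cyl {S. S \<subseteq> E \<and> conn S V L R}"
      using cyl by (auto simp: disjoint_family_on_def)
    show "cyl ` {S. S \<subseteq> E \<and> conn S V L R} \<subseteq> sets (PiM I M)"
      using EI by (auto simp: cyl_def M_def intro!: sets_PiM_I)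
  qed (use EI in simp)
  also have "\<dots> = (\<Sum>S\<in>{S. S \<subseteq> E \<and> conn S V L R}. wt E S)"
    using mcyl by (intro sum.cong) auto
  also have "\<dots> = X m n"
    unfolding X_def P_def pr_def ex_def V_def[symmetric] L_def[symmetric] R_def[symmetric] E_def[symmetric]
    using EI by (intro sum.mono_neutral_cong_left) auto
  finally show ?thesis .
qed

lemma X_pos: "0 < X m n"
proof -
  define V where "V = box k 0 (int m) 0 (int n)"
  have "((0, 0, 0), (int i, 0, 0)) \<in> (stp (edges_on V) V)\<^sup>*" if "i \<le> m" for i
    using that
  proof (induction i)
    case (Suc i)
    have "((int i, 0, 0), (int (Suc i), 0, 0)) \<in> stp (edges_on V) V"
      using Suc.prems by (auto simp: stp_def V_def nn_def intro!: edges_onI)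
    then show ?case using Suc by (auto intro: rtrancl_into_rtrancl)
  qed simp
  then have "conn (edges_on V) V (box k 0 0 0 (int n)) (box k (int m) (int m) 0 (int n))"
    unfolding conn_def by (intro bexI[of _ "(0, 0, 0)"] bexI[of _ "(int m, 0, 0)"]) (auto simp: V_def)
  then show ?thesis
    unfolding X_def P_def V_def by (intro pr_pos[of _ "edges_on V"]) (auto simp: V_def finite_edges_on)
qed

end

section \<open>Arches\<close>

text \<open>With \<open>K\<close> a cluster, these are the edges examined while exploring it,
  including the closed ones at its boundary.\<close>

definition touch :: "vertex set \<Rightarrow> vertex set \<Rightarrow> edge set" where
  "touch W K = {e \<in> edges_on W. e \<inter> K \<noteq> {}}"

lemma cluster_mono: "S \<subseteq> S' \<Longrightarrow> cluster S W C \<subseteq> cluster S' W C"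
  unfolding cluster_def using stp_rtrancl_mono[of S S' W W] by blast

text \<open>A path leaving the restricted cluster would have to use an open edge touching it, and
  all those are in \<open>F\<close>. So the edges in \<open>F\<close> certify the cluster, which is
  what \<open>pr_explore\<close> needs.\<close>

lemma cluster_Int_touch:
  assumes "S \<subseteq> edges_on V" "touch W (cluster (S \<inter> F) W C) \<subseteq> F"
  shows "cluster (S \<inter> F) W C = cluster S W C"
proof
  show "cluster (S \<inter> F) W C \<subseteq> cluster S W C" by (rule cluster_mono) simp
  show "cluster S W C \<subseteq> cluster (S \<inter> F) W C"
  proof
    fix v assume "v \<in> cluster S W C"
    then obtain c where c: "c \<in> C" "c \<in> W" "(c, v) \<in> (stp S W)\<^sup>*" unfolding cluster_def by blast
    from c(3) show "v \<in> cluster (S \<inter> F) W C"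
    proof (induction rule: rtrancl_induct)
      case base
      then show ?case using c unfolding cluster_def by blast
    next
      case (step a b)
      then have ab: "a \<in> W" "b \<in> W" "{a, b} \<in> S" by (auto simp: stp_def)
      then have "{a, b} \<in> edges_on W" using assms(1) edges_onD edges_onI by blast
      then have "{a, b} \<in> F" using assms(2) step.IH unfolding touch_def by blast
      then show ?case using cluster_step[OF step.IH] ab by blast
    qed
  qed
qed

lemma walk_in_clu: "walk S W xs \<Longrightarrow> hd xs \<in> C \<Longrightarrow> v \<in> set xs \<Longrightarrow> v \<in> cluster S W C"
  unfolding cluster_def using walk_hd_rtrancl[of S W xs v] hd_in_set[of xs] unfolding walk_def by blast

lemma walk_touch:
  assumes "S \<subseteq> edges_on V" "walk S W xs" "hd xs \<in> C"
  shows "walk (S \<inter> touch W (cluster S W C)) W xs"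
proof -
  have sub: "set xs \<subseteq> W" "set xs \<subseteq> cluster S W C" using assms walk_in_clu by (auto simp: walk_def)
  have "e \<in> touch W (cluster S W C)" if eS: "e \<in> S" "e \<subseteq> set xs" for e
  proof -
    obtain u v where e: "e = {u, v}" "nn u v" using eS(1) assms(1) unfolding edges_on_def by blast
    then have "u \<in> W" "v \<in> W" "u \<in> cluster S W C" using eS(2) sub by auto
    then show ?thesis using e edges_onI unfolding touch_def by blast
  qed
  then show ?thesis using assms(2) sub(1) by (intro walk_change[OF assms(2)]) auto
qed

text \<open>A path starting in \<open>C\<close> never leaves the cluster of \<open>C\<close>.
  Therefore the minimal path is a function of the explored edges.\<close>

lemma paths_touch:
  assumes "S \<subseteq> edges_on V"
  shows "paths (S \<inter> touch W (cluster S W C)) W C D = paths S W C D"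
proof -
  have "walk (S \<inter> touch W (cluster S W C)) W xs \<longleftrightarrow> walk S W xs" if "hd xs \<in> C" for xs
  proof
    assume w: "walk (S \<inter> touch W (cluster S W C)) W xs"
    show "walk S W xs" using w by (rule walk_change) (use w in \<open>auto simp: walk_def\<close>)
  qed (rule walk_touch[OF assms _ that])
  then show ?thesis unfolding paths_def by auto
qed

lemma lexmin_touch: "S \<subseteq> edges_on V \<Longrightarrow> lexmin (S \<inter> touch W (cluster S W C)) W C D = lexmin S W C D"
  by (intro ext) (simp add: lexmin_def paths_touch)

lemma adj2_base: "nn u v \<Longrightarrow> adj2 (base u) (base v)"
  by (cases u; cases v) (auto simp: nn_def adj2_def)

lemma walk_lat:
  assumes "S \<subseteq> edges_on V" "walk S W xs"
  shows "lat (map base xs) (base (hd xs)) (base (last xs))"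
proof -
  have "successively (\<lambda>a b. adj2 (base a) (base b)) xs"
    using assms edges_onD adj2_base unfolding walk_def by (blast intro: successively_mono)
  then show ?thesis using assms(2) by (auto simp: lat_def walk_def successively_map hd_map last_map)
qed

text \<open>A proper prefix precedes its extensions in \<open>lexord\<close>, so stopping at an
  earlier vertex of \<open>B\<close> would give a smaller path.\<close>

lemma lexmin_last_only:
  assumes "lexmin S W A B (xs @ u # ys)" "u \<in> B"
  shows "ys = []"
proof (rule ccontr)
  assume ne: "ys \<noteq> []"
  have p: "xs @ u # ys \<in> paths S W A B" using assms(1) by (simp add: lexmin_def)
  then have "xs @ [u] \<in> paths S W A B"
    using assms(2) by (auto simp: paths_def walk_def successively_append_iff successively_Cons hd_append)
  then have "(xs @ u # ys, xs @ [u]) \<in> lexord vord" using assms(1) ne by (auto simp: lexmin_def)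
  moreover have "(xs @ [u], (xs @ [u]) @ ys) \<in> lexord vord"
    using ne by (intro lexord_append_rightI) (cases ys, auto)
  ultimately show False using lexord_vord_asym by fastforce
qed

lemma common_base:
  assumes "set (map base xs) \<inter> set (map base ys) \<noteq> {}"
  shows "\<exists>g\<in>set xs. \<exists>h\<in>set ys. base g = base h"
proof -
  obtain c where c: "c \<in> base ` set xs" "c \<in> base ` set ys" using assms unfolding set_map by blast
  from c(1) obtain g where "c = base g" "g \<in> set xs" by (rule imageE)
  moreover from c(2) obtain h where "c = base h" "h \<in> set ys" by (rule imageE)
  ultimately show ?thesis by metis
qed

section \<open>Reflection in the middle line and the unexplored region\<close>

definition neg_x :: "int \<times> int \<Rightarrow> int \<times> int" where "neg_x c = (- fst c, snd c)"

lemma adj2_neg_x [simp]: "adj2 (neg_x a) (neg_x b) = adj2 a b"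
  by (auto simp: adj2_def neg_x_def)

lemma neg_x_neg_x [simp]: "neg_x (neg_x a) = a"
  by (simp add: neg_x_def)

lemma lat_neg_x: "lat xs u v \<Longrightarrow> lat (map neg_x xs) (neg_x u) (neg_x v)"
  by (auto simp: lat_def successively_map hd_map last_map)

lemma base_refl_x [simp]: "base (refl_x 0 v) = neg_x (base v)"
  by (cases v) (simp add: refl_x_def neg_x_def)

lemma lat_take: "lat (xs @ [u] @ ys) a b \<Longrightarrow> lat (xs @ [u]) a u"
  using successively_append_iff[of adj2 "xs @ [u]" ys] by (cases xs) (auto simp: lat_def)

lemma refl_x_refl_x [simp]: "refl_x t (refl_x t v) = v"
  by (cases v) (simp add: refl_x_def)

text \<open>Both \<open>\<delta>\<close> and its mirror image are removed, so that for
  \<open>V = VB\<close> the region is symmetric, unlike the set of unexplored edges.\<close>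

definition free :: "vertex set \<Rightarrow> vertex list \<Rightarrow> vertex set" where
  "free V \<delta> = {v \<in> V. base v \<notin> base ` set \<delta> \<and> neg_x (base v) \<notin> base ` set \<delta>}"

text \<open>One projected step from here leads onto the mirror image of \<open>\<delta>\<close>;
  halting before that step keeps a path inside \<open>free\<close>. The condition
  \<open>0 < fst (base u)\<close> puts the contact strictly to the left of the middle line.\<close>

definition near :: "vertex set \<Rightarrow> vertex list \<Rightarrow> vertex set" where
  "near V \<delta> = {v \<in> free V \<delta>. \<exists>u\<in>set \<delta>. 0 < fst (base u) \<and> adj2 (neg_x (base v)) (base u)}"

locale half_box = slab_perc +
  fixes d :: int
  assumes d_pos: "1 \<le> d"
begin

text \<open>\<open>JJ\<close> is the side called J in the overview. \<open>D0\<close> is fixed by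
  \<open>refl_x 0\<close>, so a path ending there joins up with its mirror image.\<close>

abbreviation "VB \<equiv> box k (- (54 * d)) (54 * d) 0 (72 * d)"
abbreviation "VP \<equiv> box k 0 (54 * d) 0 (72 * d)"
abbreviation "JJ \<equiv> box k (54 * d) (54 * d) 0 (72 * d)"
abbreviation "D0 \<equiv> box k 0 0 0 (72 * d)"
abbreviation "TT \<equiv> box k (- (54 * d)) (54 * d) (72 * d) (72 * d)"

lemma VP_VB: "VP \<subseteq> VB"
  using d_pos by (intro box_mono) auto

lemma base_VB: "v \<in> VB \<Longrightarrow> base v \<in> {- (54 * d)..54 * d} \<times> {0..72 * d}"
  by (cases v) auto

lemma base_VP: "v \<in> VP \<Longrightarrow> base v \<in> {0..54 * d} \<times> {0..72 * d}"
  by (cases v) auto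

lemma D0_iff: "v \<in> VP \<Longrightarrow> v \<in> D0 \<longleftrightarrow> fst (base v) = 0"
  by (cases v) auto

lemma colfull_free: "colfull k (free VB \<delta>)"
  unfolding colfull_def
proof (intro conjI ballI impI)
  show "free VB \<delta> \<subseteq> slab k" by (auto simp: free_def slab_def)
  fix u v assume uv: "u \<in> free VB \<delta>" "v \<in> slab k" "base v = base u"
  then have "v \<in> VB"
    using colfull_box[of k "- (54 * d)" "54 * d" 0 "72 * d"] unfolding colfull_def free_def by blast
  then show "v \<in> free VB \<delta>" using uv by (simp add: free_def)
qed

lemma refl_x_VB: "v \<in> VB \<Longrightarrow> refl_x 0 v \<in> VB"
  by (cases v) (auto simp: refl_x_def)

lemma refl_x_free: "refl_x 0 ` free VB \<delta> = free VB \<delta>"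
proof -
  have "refl_x 0 v \<in> free VB \<delta>" if "v \<in> free VB \<delta>" for v
    using that refl_x_VB by (simp add: free_def)
  then show ?thesis by (auto intro!: image_eqI[of _ _ "refl_x 0 _"])
qed

context
  fixes T \<delta>
  assumes T: "T \<subseteq> edges_on VB" and \<delta>: "lexmin T VP JJ D0 \<delta>"
begin

lemma delta: "walk T VP \<delta>" "hd \<delta> \<in> JJ" "last \<delta> \<in> D0" "\<delta> \<noteq> []" "set \<delta> \<subseteq> VP"
  using \<delta> by (auto simp: lexmin_def paths_def walk_def)

lemma base_delta: "u \<in> set \<delta> \<Longrightarrow> base u \<in> {0..54 * d} \<times> {0..72 * d}"
  using base_VP delta(5) by blast

text \<open>By minimality \<open>\<delta>\<close> meets the middle line only at its end, so its part
  from the right side to \<open>u\<close> keeps a positive first coordinate. Read backwards, that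
  part is the extension of a path from \<open>u\<close> to the right side; reflected, it leads to
  the left side.\<close>

lemma initial_part:
  assumes "u \<in> set \<delta>" "0 < fst (base u)"
  shows "\<exists>xs y. lat xs (base u) (54 * d, y) \<and> set xs \<subseteq> base ` set \<delta> \<and> set xs \<subseteq> {1..54 * d} \<times> {0..72 * d}"
proof -
  obtain \<delta>0 \<delta>1 where split: "\<delta> = \<delta>0 @ [u] @ \<delta>1" using assms(1) by (auto simp: in_set_conv_decomp)
  have pos: "0 < fst (base w)" if "w \<in> set (\<delta>0 @ [u])" for w
  proof (cases "w = u")
    case False
    then have "w \<in> set \<delta>0" using that by simp
    then obtain ys zs where s: "\<delta>0 = ys @ w # zs" by (auto simp: in_set_conv_decomp)
    have "w \<notin> D0"
    proof
      assume "w \<in> D0"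
      then have "zs @ [u] @ \<delta>1 = []"
        using lexmin_last_only[of T VP JJ D0 ys w "zs @ [u] @ \<delta>1"] \<delta> unfolding split s by simp
      then show False by simp
    qed
    then have "fst (base w) \<noteq> 0" using D0_iff delta(5) unfolding split s by auto
    moreover have "0 \<le> fst (base w)" using base_delta[of w] unfolding split s by auto
    ultimately show ?thesis by simp
  qed (use assms in simp)
  have "lat (map base \<delta>) (base (hd \<delta>)) (base (last \<delta>))" using walk_lat[OF T delta(1)] .
  then have "lat (map base (\<delta>0 @ [u])) (base (hd \<delta>)) (base u)"
    unfolding split using lat_take[of "map base \<delta>0" "base u" "map base \<delta>1"] by simp
  then have "lat (rev (map base (\<delta>0 @ [u]))) (base u) (base (hd \<delta>))" by (rule lat_rev)
  moreover have "base (hd \<delta>) = (54 * d, snd (base (hd \<delta>)))" using delta(2) by (cases "hd \<delta>") auto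
  moreover have "set (map base (\<delta>0 @ [u])) \<subseteq> base ` set \<delta>" unfolding split by auto
  moreover have "set (map base (\<delta>0 @ [u])) \<subseteq> {1..54 * d} \<times> {0..72 * d}"
  proof
    fix c assume "c \<in> set (map base (\<delta>0 @ [u]))"
    then have "c \<in> base ` set (\<delta>0 @ [u])" by (simp only: set_map)
    then obtain w where w: "c = base w" "w \<in> set (\<delta>0 @ [u])" by (rule imageE)
    then have "w \<in> set \<delta>" unfolding split by auto
    then show "c \<in> {1..54 * d} \<times> {0..72 * d}" using pos[OF w(2)] base_delta[of w] w(1) by (cases c) auto
  qed
  ultimately show ?thesis by (metis set_rev)
qed

text \<open>Extended along the columns of \<open>\<delta>\<close> and of its mirror image, the two paths join the bottom to opposite
  sides, and they start in the wrong order.\<close>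
lemma free_paths_meet:
  assumes S: "S \<subseteq> edges_on VB" and s: "0 < s"
    and \<gamma>: "\<gamma> \<in> paths S (free VB \<delta>) (seg d s) (near VB \<delta>)"
    and \<eta>: "\<eta> \<in> paths S (free VB \<delta>) (refl_x 0 ` seg d s) (refl_x 0 ` near VB \<delta>)"
  shows "\<exists>g\<in>set \<gamma>. \<exists>h\<in>set \<eta>. base g = base h"
proof -
  have \<gamma>': "walk S (free VB \<delta>) \<gamma>" "hd \<gamma> \<in> seg d s" "last \<gamma> \<in> near VB \<delta>" "set \<gamma> \<subseteq> free VB \<delta>"
    using \<gamma> by (auto simp: paths_def walk_def)
  have \<eta>': "walk S (free VB \<delta>) \<eta>" "hd \<eta> \<in> refl_x 0 ` seg d s" "last \<eta> \<in> refl_x 0 ` near VB \<delta>" "set \<eta> \<subseteq> free VB \<delta>"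
    using \<eta> by (auto simp: paths_def walk_def)
  obtain u where u: "u \<in> set \<delta>" "0 < fst (base u)" "adj2 (neg_x (base (last \<gamma>))) (base u)"
    using \<gamma>'(3) by (auto simp: near_def)
  obtain v where v: "v \<in> set \<delta>" "0 < fst (base v)" "adj2 (base (last \<eta>)) (base v)"
    using \<eta>'(3) by (auto simp: near_def)
  obtain xs y where xs: "lat xs (base u) (54 * d, y)" "set xs \<subseteq> base ` set \<delta>" "set xs \<subseteq> {1..54 * d} \<times> {0..72 * d}"
    using initial_part[OF u(1,2)] by blast
  obtain ys y' where ys: "lat ys (base v) (54 * d, y')" "set ys \<subseteq> base ` set \<delta>" "set ys \<subseteq> {1..54 * d} \<times> {0..72 * d}"
    using initial_part[OF v(1,2)] by blast
  have a: "adj2 (base (last \<gamma>)) (neg_x (base u))" using u(3) adj2_neg_x[of "base (last \<gamma>)" "neg_x (base u)"] adj2_neg_x neg_x_neg_x by metis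
  have L1: "lat (map base \<gamma> @ map neg_x xs) (base (hd \<gamma>)) (neg_x (54 * d, y))"
    using lat_append[OF walk_lat[OF S \<gamma>'(1)] lat_neg_x[OF xs(1)] a] .
  have L2: "lat (map base \<eta> @ ys) (base (hd \<eta>)) (54 * d, y')"
    using lat_append[OF walk_lat[OF S \<eta>'(1)] ys(1) v(3)] .
  obtain j where j: "base (hd \<gamma>) = (j, 0)" "0 < j" using \<gamma>'(2) s by (cases "hd \<gamma>") (auto simp: seg_def)
  obtain i where i: "base (hd \<eta>) = (i, 0)" "i < 0" using \<eta>'(2) s by (cases "hd \<eta>") (auto simp: seg_def refl_x_def)
  have "base ` free VB \<delta> \<subseteq> {- (54 * d)..54 * d} \<times> {0..72 * d}" using base_VB by (auto simp: free_def)
  then have sub: "set (map base \<gamma>) \<subseteq> {- (54 * d)..54 * d} \<times> {0..72 * d}" "set (map base \<eta>) \<subseteq> {- (54 * d)..54 * d} \<times> {0..72 * d}"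
    using \<gamma>'(4) \<eta>'(4) by auto
  have subx: "set (map neg_x xs) \<subseteq> {- (54 * d)..-1} \<times> {0..72 * d}" using xs(3) by (auto simp: neg_x_def)
  have "set (map base \<gamma> @ map neg_x xs) \<inter> set (map base \<eta> @ ys) \<noteq> {}"
  proof (rule left_right_meet)
    show "lat (map base \<gamma> @ map neg_x xs) (j, 0) (- (54 * d), y)" using L1 j by (simp add: neg_x_def)
    show "lat (map base \<eta> @ ys) (i, 0) (54 * d, y')" using L2 i by simp
    show "set (map base \<gamma> @ map neg_x xs) \<subseteq> {- (54 * d)..54 * d} \<times> {0..72 * d}" using sub(1) subx d_pos unfolding set_append by (intro Un_least) auto
    show "set (map base \<eta> @ ys) \<subseteq> {- (54 * d)..54 * d} \<times> {0..72 * d}" using sub(2) ys(3) d_pos unfolding set_append by (intro Un_least) auto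
    show "i < j" using i j by simp
  qed
  then obtain c where c: "c \<in> set (map base \<gamma>) \<or> c \<in> neg_x ` set xs" "c \<in> set (map base \<eta>) \<or> c \<in> set ys" by auto
  \<comment> \<open>Free paths avoid the columns of \<open>\<delta>\<close> and of its mirror image,
    over which the extensions run, and the two extensions lie on opposite sides of the middle line.
    So the common point is on \<open>\<gamma>\<close> and \<open>\<eta>\<close>.\<close>
  have n1: "c \<notin> base ` set \<delta> \<and> neg_x c \<notin> base ` set \<delta>" if "c \<in> set (map base \<gamma>) \<or> c \<in> set (map base \<eta>)"
    using that \<gamma>'(4) \<eta>'(4) unfolding free_def by auto
  have n2: "neg_x c \<in> base ` set \<delta> \<and> fst c < 0" if "c \<in> neg_x ` set xs"
    using that xs(2) subx by (auto simp: neg_x_def)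
  have n3: "c \<in> base ` set \<delta> \<and> 0 < fst c" if "c \<in> set ys"
    using that ys(2,3) by auto
  have "c \<in> set (map base \<gamma>) \<and> c \<in> set (map base \<eta>)"
    using c n1 n2 n3 by (metis less_asym)
  then show ?thesis by auto
qed

text \<open>The region \<open>free VB \<delta>\<close> is its own mirror image, so the reflected
  event is equally likely, and gluing the two produces the square. Here \<open>\<delta>\<close> is
  fixed and all edges are random.\<close>

lemma pr_free_near:
  assumes "0 < s"
  shows "(P (free VB \<delta>) (seg d s) (near VB \<delta>))\<^sup>2 \<le> (1 + 2 * glue_const k) * P VB (seg d s) (refl_x 0 ` seg d s)"
proof -
  let ?D = "free VB \<delta>" and ?N = "near VB \<delta>" and ?I = "seg d s" and ?m = "\<lambda>A. refl_x 0 ` A"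
  have DV: "?D \<subseteq> VB" by (auto simp: free_def)
  have fin: "finite ?D" by (rule finite_subset[OF DV finite_box])
  have full: "colfull k (A \<inter> ?D)" if "colfull k A" for A
    using that colfull_free[of \<delta>] unfolding colfull_def by blast
  have If: "colfull k ?I" "colfull k (?m ?I)" unfolding seg_def refl_x_box by simp_all
  have N: "?N \<subseteq> ?D" by (auto simp: near_def)
  have pr_D: "pr (edges_on VB) (\<lambda>S. conn S ?D (A \<inter> ?D) B) = P ?D A B" for A B
    unfolding P_eq[OF finite_box DV] using fin by (intro antisym P_mono) auto
  have "P ?D (?m ?I) (?m ?N) = P (?m ?D) (?m ?I) (?m ?N)" by (simp add: refl_x_free)
  also have "\<dots> = P ?D ?I ?N" by (rule P_refl_x[OF fin])
  finally have mir: "P ?D (?m ?I) (?m ?N) = P ?D ?I ?N" .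
  have "P ?D ?I ?N * P ?D (?m ?I) (?m ?N) \<le> (1 + 2 * glue_const k) * pr (edges_on VB) (\<lambda>S. conn S ?D (?I \<inter> ?D) (?m ?I \<inter> ?D))"
    unfolding pr_D[symmetric]
  proof (rule pr_glue_crossing)
    fix S \<gamma> \<eta>
    assume "S \<subseteq> edges_on VB" "\<gamma> \<in> paths S ?D (?I \<inter> ?D) ?N" "\<eta> \<in> paths S ?D (?m ?I \<inter> ?D) (?m ?N)"
    then show "\<exists>g\<in>set \<gamma>. \<exists>h\<in>set \<eta>. base g = base h"
      using assms by (intro free_paths_meet) (auto simp: paths_def)
  qed (use DV box_slab colfull_free full If in auto)
  also have "\<dots> \<le> (1 + 2 * glue_const k) * P VB ?I (?m ?I)"
  proof (rule mult_left_mono)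
    show "pr (edges_on VB) (\<lambda>S. conn S ?D (?I \<inter> ?D) (?m ?I \<inter> ?D)) \<le> P VB ?I (?m ?I)"
      unfolding P_eq[OF finite_box DV] using DV by (intro P_mono finite_box) auto
    show "0 \<le> 1 + 2 * glue_const k" using p_pos p_less_1 by (simp add: glue_const_def)
  qed
  finally show ?thesis by (simp add: mir power2_eq_square)
qed

text \<open>Joined at the middle line, \<open>\<delta>\<close> and its mirror image cross
  \<open>VB\<close> from side to side, so \<open>\<gamma>\<close> meets them in projection. Contact
  with \<open>\<delta>\<close> is excluded by \<open>avoid\<close>; the last vertex before the first
  contact with the mirror image is in \<open>near\<close>.\<close>

lemma reach_near:
  assumes S: "S \<subseteq> edges_on VB" and s: "0 < s"
    and \<gamma>: "walk S VB \<gamma>" "hd \<gamma> \<in> seg d s" "last \<gamma> \<in> TT" and avoid: "\<And>g h. g \<in> set \<gamma> \<Longrightarrow> h \<in> set \<delta> \<Longrightarrow> base g \<noteq> base h"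
  shows "conn S (free VB \<delta>) (seg d s) (near VB \<delta>)"
proof -
  let ?B = "{- (54 * d)..54 * d} \<times> {0..72 * d}"
  have \<gamma>V: "\<gamma> \<noteq> []" "set \<gamma> \<subseteq> VB" using \<gamma>(1) by (auto simp: walk_def)
  have L\<delta>: "lat (map base \<delta>) (base (hd \<delta>)) (base (last \<delta>))" using walk_lat[OF T delta(1)] .
  obtain y where y: "base (hd \<delta>) = (54 * d, y)" using delta(2) by (cases "hd \<delta>") auto
  obtain y' where y': "base (last \<delta>) = (0, y')" using delta(3) by (cases "last \<delta>") auto
  have LH: "lat (map neg_x (map base \<delta>) @ rev (map base \<delta>)) (- (54 * d), y) (54 * d, y)"
    using lat_append[OF lat_neg_x[OF L\<delta>] lat_rev[OF L\<delta>]] unfolding y y' by (simp add: neg_x_def adj2_def)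
  have LV: "lat (map base \<gamma>) (base (hd \<gamma>)) (base (last \<gamma>))" using walk_lat[OF S \<gamma>(1)] .
  obtain j where j: "base (hd \<gamma>) = (j, 0)" "0 < j" using \<gamma>(2) s by (cases "hd \<gamma>") (auto simp: seg_def)
  obtain i where i: "base (last \<gamma>) = (i, 72 * d)" using \<gamma>(3) by (cases "last \<gamma>") auto
  have "set (map neg_x (map base \<delta>) @ rev (map base \<delta>)) \<inter> set (map base \<gamma>) \<noteq> {}"
  proof (rule lat_crossings_meet[OF LH])
    show "lat (map base \<gamma>) (j, 0) (i, 72 * d)" using LV i j by simp
    show "set (map base \<gamma>) \<subseteq> ?B" using \<gamma>V base_VB by auto
    have "set (map base \<delta>) \<subseteq> {0..54 * d} \<times> {0..72 * d}" using base_delta by auto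
    then show "set (map neg_x (map base \<delta>) @ rev (map base \<delta>)) \<subseteq> ?B"
      using d_pos by (auto simp: neg_x_def)
  qed
  then obtain c where "c \<in> neg_x ` base ` set \<delta> \<or> c \<in> base ` set \<delta>" "c \<in> base ` set \<gamma>"
    unfolding set_append set_rev set_map by blast
  moreover from this(2) obtain v0 where "c = base v0" "v0 \<in> set \<gamma>" by (rule imageE)
  ultimately have v0: "v0 \<in> set \<gamma>" "base v0 \<in> neg_x ` base ` set \<delta> \<or> base v0 \<in> base ` set \<delta>"
    by simp_all
  then have "base v0 \<in> neg_x ` base ` set \<delta>" using avoid by blast
  then have ex: "\<exists>v\<in>set \<gamma>. neg_x (base v) \<in> base ` set \<delta>" using v0(1) by force
  obtain \<gamma>0 v \<gamma>1 where split: "\<gamma> = \<gamma>0 @ v # \<gamma>1" "neg_x (base v) \<in> base ` set \<delta>"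
    "\<forall>w\<in>set \<gamma>0. neg_x (base w) \<notin> base ` set \<delta>"
    using split_list_first_prop[OF ex] by blast
  obtain u where u: "u \<in> set \<delta>" "base u = neg_x (base v)" using split(2) by (metis imageE)
  \<comment> \<open>A column on the middle line is its own mirror image, so contact there would be
    contact with \<open>\<delta>\<close>.\<close>
  have vneg: "fst (base v) < 0"
  proof -
    have "0 \<le> fst (base u)" using base_delta[OF u(1)] by auto
    moreover have "fst (base u) \<noteq> 0"
    proof
      assume "fst (base u) = 0"
      then have "base v = base u" using u(2) by (simp add: neg_x_def prod_eq_iff)
      then show False using avoid[of v u] u(1) split(1) by auto
    qed
    ultimately show ?thesis using u(2) by (simp add: neg_x_def)
  qed
  \<comment> \<open>\<open>\<gamma>\<close> starts to the right of the middle line, so some vertex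
    precedes \<open>v\<close>.\<close>
  have ne: "\<gamma>0 \<noteq> []" using j vneg split(1) by auto
  have sub: "set \<gamma>0 \<subseteq> free VB \<delta>"
  proof
    fix w assume "w \<in> set \<gamma>0"
    moreover from this have "w \<in> set \<gamma>" using split(1) by simp
    then have "base w \<notin> base ` set \<delta>" "w \<in> VB" using avoid \<gamma>V(2) by blast+
    ultimately show "w \<in> free VB \<delta>" using split(3) by (simp add: free_def)
  qed
  have w0: "walk S (free VB \<delta>) \<gamma>0"
    using \<gamma>(1) ne sub unfolding split(1) walk_def by (auto simp: successively_append_iff)
  have "{last \<gamma>0, v} \<in> S" using \<gamma>(1) ne unfolding split(1) walk_def by (auto simp: successively_append_iff)
  then have "adj2 (base (last \<gamma>0)) (base v)" using S edges_onD adj2_base by blast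
  then have "adj2 (neg_x (base (last \<gamma>0))) (base u)" using u(2) by simp
  moreover have "0 < fst (base u)" using u(2) vneg by (simp add: neg_x_def)
  moreover have "last \<gamma>0 \<in> free VB \<delta>" using sub ne by auto
  ultimately have "last \<gamma>0 \<in> near VB \<delta>" unfolding near_def using u(1) by blast
  moreover have "hd \<gamma>0 \<in> seg d s" using \<gamma>(2) ne unfolding split(1) by simp
  ultimately show ?thesis
    using ne hd_in_set last_in_set by (intro walk_cn[OF w0, of "hd \<gamma>0" _ "last \<gamma>0"]) blast+
qed

end


text \<open>FKG supplies \<open>\<gamma>\<close> and \<open>\<delta>\<close> together. The case
  \<open>glue\<close> is handled by \<open>pr_glue\<close>; in the case \<open>bad\<close> the
  cluster of \<open>JJ\<close> in \<open>VP\<close> is explored, and the square root undoes the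
  square in \<open>pr_free_near\<close>.\<close>

lemma mirror_or_side:
  assumes "0 < s"
  shows "P VP JJ D0 * P VB (seg d s) TT \<le>
    sqrt ((1 + 2 * glue_const k) * P VB (seg d s) (refl_x 0 ` seg d s)) + (1 + 2 * glue_const k) * P VB (seg d s) JJ"
    (is "_ \<le> ?y + _")
proof -
  let ?E = "edges_on VB" and ?I = "seg d s"
  define glue where "glue S \<longleftrightarrow> conn S VB ?I JJ \<or> (\<exists>\<gamma> \<delta>. lexmin S VB ?I TT \<gamma> \<and> lexmin S VP JJ D0 \<delta> \<and>
    (\<exists>g\<in>set \<gamma>. \<exists>h\<in>set \<delta>. base g = base h))" for S
  define bad where "bad S \<longleftrightarrow> (\<exists>\<gamma> \<delta>. lexmin S VB ?I TT \<gamma> \<and> lexmin S VP JJ D0 \<delta> \<and>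
    (\<forall>g\<in>set \<gamma>. \<forall>h\<in>set \<delta>. base g \<noteq> base h)) \<and> \<not> conn S VB ?I JJ" for S
  have finE: "finite ?E" by (simp add: finite_edges_on)
  have y0: "0 \<le> ?y" using p_pos p_less_1 by (simp add: glue_const_def)
  have "P VP JJ D0 * P VB ?I TT = pr ?E (\<lambda>S. conn S VP JJ D0) * pr ?E (\<lambda>S. conn S VB ?I TT)"
    by (simp add: P_eq VP_VB)
  also have "\<dots> \<le> pr ?E (\<lambda>S. conn S VP JJ D0 \<and> conn S VB ?I TT)"
    using finE by (rule pr_fkg) (auto elim: conn_mono[rotated -1])
  also have "\<dots> \<le> pr ?E bad + pr ?E glue"
  proof (rule pr_union2)
    fix S assume "conn S VP JJ D0 \<and> conn S VB ?I TT"
    then obtain \<gamma> \<delta> where "lexmin S VB ?I TT \<gamma>" "lexmin S VP JJ D0 \<delta>"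
      using lexmin_exists[OF finite_box] by meson
    then show "bad S \<or> glue S" unfolding glue_def bad_def by blast
  qed
  also have "pr ?E glue \<le> (1 + 2 * glue_const k) * pr ?E (\<lambda>S. conn S VB ?I JJ)"
    unfolding glue_def by (rule pr_glue) (use VP_VB box_slab in \<open>simp_all add: seg_def\<close>)
  also have "pr ?E bad \<le> ?y"
  proof (rule pr_explore[OF finE, where \<kappa> = "\<lambda>S. touch VP (cluster S VP JJ)"
        and B = "\<lambda>T S. \<exists>\<delta>. lexmin T VP JJ D0 \<delta> \<and> conn S (free VB \<delta>) ?I (near VB \<delta>)"])
    show "touch VP (cluster S VP JJ) \<subseteq> ?E" for S
      using edges_on_mono[OF VP_VB] by (auto simp: touch_def)
    show "touch VP (cluster (S \<inter> touch VP (cluster S VP JJ)) VP JJ) = touch VP (cluster S VP JJ)" if "S \<subseteq> ?E" for S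
    proof -
      have "touch VP (cluster (S \<inter> touch VP (cluster S VP JJ)) VP JJ) \<subseteq> touch VP (cluster S VP JJ)"
        using cluster_mono[of "S \<inter> touch VP (cluster S VP JJ)" S VP JJ] by (auto simp: touch_def)
      then have "cluster (S \<inter> touch VP (cluster S VP JJ)) VP JJ = cluster S VP JJ" by (rule cluster_Int_touch[OF that])
      then show ?thesis by (rule arg_cong)
    qed
    show "touch VP (cluster S VP JJ) = F" if "S \<subseteq> ?E" "touch VP (cluster (S \<inter> F) VP JJ) = F" for S F
      using cluster_Int_touch[OF that(1), of VP F JJ] that(2) by simp
    show "0 \<le> ?y" by (rule y0)
  next
    fix S assume S: "S \<subseteq> ?E" "bad S"
    let ?F = "touch VP (cluster S VP JJ)"
    obtain \<gamma> \<delta> where \<gamma>: "lexmin S VB ?I TT \<gamma>" and \<delta>: "lexmin S VP JJ D0 \<delta>"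
      and avoid: "\<And>g h. g \<in> set \<gamma> \<Longrightarrow> h \<in> set \<delta> \<Longrightarrow> base g \<noteq> base h" and ncn: "\<not> conn S VB ?I JJ"
      using S(2) unfolding bad_def by blast
    have w: "walk S VB \<gamma>" "hd \<gamma> \<in> ?I" "last \<gamma> \<in> TT" using \<gamma> by (auto simp: lexmin_def paths_def)
    \<comment> \<open>A vertex of \<open>\<gamma>\<close> in the explored cluster would connect the
      segment to \<open>JJ\<close>. Hence no edge of \<open>\<gamma>\<close> has been
      explored.\<close>
    have nclu: "v \<notin> cluster S VP JJ" if v: "v \<in> set \<gamma>" for v
    proof
      assume "v \<in> cluster S VP JJ"
      then obtain c where c: "c \<in> JJ" "(c, v) \<in> (stp S VP)\<^sup>*" unfolding cluster_def by blast
      then have "(v, c) \<in> (stp S VB)\<^sup>*" using stp_rtrancl_mono[OF order_refl VP_VB] stp_rtrancl_sym by metis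
      moreover have "(hd \<gamma>, v) \<in> (stp S VB)\<^sup>*" "hd \<gamma> \<in> VB"
        using walk_hd_rtrancl[OF w(1) v] w(1) hd_in_set unfolding walk_def by blast+
      ultimately show False using ncn c(1) w(2) unfolding conn_def by (meson IntI rtrancl_trans)
    qed
    have "walk (S - ?F) VB \<gamma>"
      using w(1) by (rule walk_change) (use nclu w(1) in \<open>auto simp: touch_def walk_def\<close>)
    then have "conn (S - ?F) (free VB \<delta>) ?I (near VB \<delta>)"
      using reach_near[OF S(1) \<delta> _ assms _ w(2,3) avoid] S(1) by blast
    moreover have "lexmin (S \<inter> ?F) VP JJ D0 \<delta>" using lexmin_touch[OF S(1)] \<delta> by simp
    ultimately show "\<exists>\<delta>. lexmin (S \<inter> ?F) VP JJ D0 \<delta> \<and> conn (S - ?F) (free VB \<delta>) ?I (near VB \<delta>)" by blast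
  next
    fix T F assume T: "T \<subseteq> F" "F \<subseteq> ?E"
    show "pr (?E - F) (\<lambda>S. \<exists>\<delta>. lexmin T VP JJ D0 \<delta> \<and> conn S (free VB \<delta>) ?I (near VB \<delta>)) \<le> ?y"
    proof (cases "\<exists>\<delta>. lexmin T VP JJ D0 \<delta>")
      case False
      then show ?thesis using y0 by (simp add: pr_def ex_def)
    next
      case True
      then obtain \<delta> where \<delta>: "lexmin T VP JJ D0 \<delta>" by blast
      have DV: "free VB \<delta> \<subseteq> VB" by (auto simp: free_def)
      have "pr (?E - F) (\<lambda>S. \<exists>\<delta>. lexmin T VP JJ D0 \<delta> \<and> conn S (free VB \<delta>) ?I (near VB \<delta>))
        = pr (?E - F) (\<lambda>S. conn S (free VB \<delta>) ?I (near VB \<delta>))"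
        using \<delta> lexmin_unique by (intro pr_cong) blast
      \<comment> \<open>The edge set \<open>?E - F\<close> is not symmetric. The event is
        increasing, so making the explored edges random again can only raise its probability, and it
        restores a measure invariant under reflection.\<close>
      also have "\<dots> = pr (?E - F) (\<lambda>S. conn (S \<inter> (?E - F)) (free VB \<delta>) ?I (near VB \<delta>))"
        by (intro pr_cong) (simp add: Int_absorb2)
      also have "\<dots> = pr ?E (\<lambda>S. conn (S \<inter> (?E - F)) (free VB \<delta>) ?I (near VB \<delta>))"
        using finE by (intro pr_marginal[symmetric]) (auto simp: Int_assoc)
      also have "\<dots> \<le> pr ?E (\<lambda>S. conn S (free VB \<delta>) ?I (near VB \<delta>))"
        by (intro pr_mono) (auto elim: conn_mono[rotated -1])
      also have "\<dots> = P (free VB \<delta>) ?I (near VB \<delta>)" by (rule P_eq[OF finite_box DV])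
      also have "\<dots> \<le> ?y"
        using pr_free_near[OF _ \<delta> assms] T by (intro real_le_rsqrt) auto
      finally show ?thesis .
    qed
  qed
  finally show ?thesis by (simp add: P_def)
qed

text \<open>A path from the right-hand segment to the top separates the left-hand segment from the
  right side, so the two paths meet in projection. The condition \<open>d < s' - s\<close> makes the
  segments disjoint.\<close>

lemma side_imp_shifted:
  assumes "d < s' - s"
  shows "P VB (seg d s') TT * P VB (seg d s) JJ \<le> (1 + 2 * glue_const k) * P VB (seg d s) (seg d s')"
proof -
  have "pr (edges_on VB) (\<lambda>S. conn S VB (seg d s') TT) * pr (edges_on VB) (\<lambda>S. conn S VB (seg d s) JJ)
    \<le> (1 + 2 * glue_const k) * pr (edges_on VB) (\<lambda>S. conn S VB (seg d s') (seg d s))"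
  proof (rule pr_glue_crossing)
    fix S \<gamma> \<eta>
    assume S: "S \<subseteq> edges_on VB" and "\<gamma> \<in> paths S VB (seg d s') TT" "\<eta> \<in> paths S VB (seg d s) JJ"
    then have \<gamma>: "walk S VB \<gamma>" "hd \<gamma> \<in> seg d s'" "last \<gamma> \<in> TT" "set \<gamma> \<subseteq> VB"
      and \<eta>: "walk S VB \<eta>" "hd \<eta> \<in> seg d s" "last \<eta> \<in> JJ" "set \<eta> \<subseteq> VB" by (auto simp: paths_def walk_def)
    obtain j where j: "base (hd \<gamma>) = (j, 0)" "s' \<le> j" using \<gamma>(2) by (cases "hd \<gamma>") (auto simp: seg_def)
    obtain i where i: "base (hd \<eta>) = (i, 0)" "i \<le> s + d" using \<eta>(2) by (cases "hd \<eta>") (auto simp: seg_def)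
    obtain x where x: "base (last \<gamma>) = (x, 72 * d)" using \<gamma>(3) by (cases "last \<gamma>") auto
    obtain y where y: "base (last \<eta>) = (54 * d, y)" using \<eta>(3) by (cases "last \<eta>") auto
    have sub: "base ` set \<gamma> \<subseteq> {- (54 * d)..54 * d} \<times> {0..72 * d}" "base ` set \<eta> \<subseteq> {- (54 * d)..54 * d} \<times> {0..72 * d}"
      using \<gamma>(4) \<eta>(4) base_VB by blast+
    have "set (map base \<gamma>) \<inter> set (map base \<eta>) \<noteq> {}"
      unfolding Int_commute[of "set (map base \<gamma>)"]
      using walk_lat[OF S \<eta>(1)] walk_lat[OF S \<gamma>(1)] sub assms i j unfolding x y
      by (intro right_top_meet[of _ i "54 * d" y "- (54 * d)" "72 * d" _ j x]) simp_all
    then show "\<exists>g\<in>set \<gamma>. \<exists>h\<in>set \<eta>. base g = base h" by (rule common_base)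
  qed (use box_slab in \<open>simp_all add: seg_def\<close>)
  then show ?thesis unfolding P_def by (simp add: conn_commute[of _ _ "seg d s'" "seg d s"])
qed

text \<open>The arch obtained so far is glued to the original arch translated by
  \<open>2 * d * (m + 1)\<close>. Since segments have length \<open>d\<close>, moving the right foot
  by another \<open>2 * d\<close> separates it from its previous position, and the gap
  \<open>3 * d\<close> puts the left foot of the translate strictly between the feet of the long
  arch.\<close>

lemma chain_step:
  assumes s: "3 * d < s2 - s1" "0 \<le> m"
  shows "P (box k (- (54 * d)) (54 * d + 2 * d * m) 0 (72 * d)) (seg d s1) (seg d (s2 + 2 * d * m)) * P VB (seg d s1) (seg d s2)
    \<le> (1 + 2 * glue_const k) *
      P (box k (- (54 * d)) (54 * d + 2 * d * (m + 1)) 0 (72 * d)) (seg d s1) (seg d (s2 + 2 * d * (m + 1)))"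
proof -
  define t where "t = 2 * d * m"
  define r where "r = 54 * d + t + 2 * d"
  have t: "0 \<le> t" using s(2) d_pos by (simp add: t_def)
  let ?R = "box k (- (54 * d)) r 0 (72 * d)" and ?R1 = "box k (- (54 * d)) (54 * d + t) 0 (72 * d)"
  let ?R2 = "box k (- (54 * d) + (t + 2 * d)) (54 * d + (t + 2 * d)) 0 (72 * d)"
  let ?A = "seg d s1" and ?B = "seg d (s2 + t)" and ?C = "seg d (s2 + (t + 2 * d))" and ?D = "seg d (s1 + (t + 2 * d))"
  have sub: "?R1 \<subseteq> ?R" "?R2 \<subseteq> ?R" using t d_pos by (auto intro!: box_mono simp: r_def)
  have "P (shift (t + 2 * d) 0 ` VB) (shift (t + 2 * d) 0 ` seg d s1) (shift (t + 2 * d) 0 ` seg d s2) = P VB (seg d s1) (seg d s2)"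
    by (rule P_shift) simp
  then have "P ?R2 ?D ?C = P VB (seg d s1) (seg d s2)"
    unfolding seg_def shift_box by (simp add: algebra_simps)
  then have sh: "P ?R2 ?C ?D = P VB (seg d s1) (seg d s2)" by (simp add: P_commute)
  have "pr (edges_on ?R) (\<lambda>S. conn S ?R1 ?A ?B) * pr (edges_on ?R) (\<lambda>S. conn S ?R2 ?C ?D)
    \<le> (1 + 2 * glue_const k) * pr (edges_on ?R) (\<lambda>S. conn S ?R ?A ?C)"
  proof (rule pr_glue_crossing)
    fix S \<gamma> \<eta>
    assume S: "S \<subseteq> edges_on ?R" and "\<gamma> \<in> paths S ?R1 ?A ?B" "\<eta> \<in> paths S ?R2 ?C ?D"
    then have \<gamma>: "walk S ?R1 \<gamma>" "hd \<gamma> \<in> ?A" "last \<gamma> \<in> ?B" "set \<gamma> \<subseteq> ?R"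
      and \<eta>: "walk S ?R2 \<eta>" "hd \<eta> \<in> ?C" "last \<eta> \<in> ?D" "set \<eta> \<subseteq> ?R"
      using sub by (auto simp: paths_def walk_def)
    obtain i1 where i1: "base (hd \<gamma>) = (i1, 0)" "i1 \<le> s1 + d"
      using \<gamma>(2) by (cases "hd \<gamma>") (auto simp: seg_def)
    obtain i2 where i2: "base (last \<eta>) = (i2, 0)" "s1 + (t + 2 * d) \<le> i2" "i2 \<le> s1 + (t + 2 * d) + d"
      using \<eta>(3) by (cases "last \<eta>") (auto simp: seg_def)
    obtain i3 where i3: "base (last \<gamma>) = (i3, 0)" "s2 + t \<le> i3" "i3 \<le> s2 + t + d"
      using \<gamma>(3) by (cases "last \<gamma>") (auto simp: seg_def)
    obtain i4 where i4: "base (hd \<eta>) = (i4, 0)" "s2 + (t + 2 * d) \<le> i4"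
      using \<eta>(2) by (cases "hd \<eta>") (auto simp: seg_def)
    have "base ` ?R \<subseteq> {- (54 * d)..r} \<times> {0..72 * d}" by auto
    then have sb: "base ` set \<gamma> \<subseteq> {- (54 * d)..r} \<times> {0..72 * d}" "base ` set \<eta> \<subseteq> {- (54 * d)..r} \<times> {0..72 * d}"
      using \<gamma>(4) \<eta>(4) by blast+
    have "set (map base \<gamma>) \<inter> set (rev (map base \<eta>)) \<noteq> {}"
    proof (rule arches_meet)
      show "lat (map base \<gamma>) (i1, 0) (i3, 0)" using walk_lat[OF S \<gamma>(1)] i1 i3 by simp
      show "lat (rev (map base \<eta>)) (i2, 0) (i4, 0)" using lat_rev[OF walk_lat[OF S \<eta>(1)]] i2 i4 by simp
      show "set (map base \<gamma>) \<subseteq> {- (54 * d)..r} \<times> {0..72 * d}" "set (rev (map base \<eta>)) \<subseteq> {- (54 * d)..r} \<times> {0..72 * d}"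
        using sb by simp_all
    qed (use i1 i2 i3 i4 s t d_pos in linarith)+
    then show "\<exists>g\<in>set \<gamma>. \<exists>h\<in>set \<eta>. base g = base h" unfolding set_rev by (rule common_base)
  qed (use box_slab sub in \<open>simp_all add: seg_def\<close>)
  then have "P ?R1 ?A ?B * P ?R2 ?C ?D \<le> (1 + 2 * glue_const k) * P ?R ?A ?C"
    by (simp only: P_eq[OF finite_box sub(1)] P_eq[OF finite_box sub(2)] P_eq[OF finite_box order_refl])
  moreover have "2 * d * (m + 1) = t + 2 * d" "2 * d * m = t" "54 * d + (t + 2 * d) = r"
    by (simp_all add: t_def r_def algebra_simps)
  ultimately show ?thesis unfolding sh by simp
qed

lemma chain:
  assumes s: "3 * d < s2 - s1" and c: "0 \<le> c" "c \<le> P VB (seg d s1) (seg d s2)"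
  shows "c * (c / (1 + 2 * glue_const k)) ^ m \<le>
    P (box k (- (54 * d)) (54 * d + 2 * d * int m) 0 (72 * d)) (seg d s1) (seg d (s2 + 2 * d * int m))"
proof (induction m)
  case (Suc m)
  let ?K = "1 + 2 * glue_const k"
  have K: "0 < ?K" using p_pos p_less_1 by (simp add: glue_const_def add_pos_nonneg)
  let ?Q = "P (box k (- (54 * d)) (54 * d + 2 * d * (int m + 1)) 0 (72 * d)) (seg d s1) (seg d (s2 + 2 * d * (int m + 1)))"
  have "c * (c / ?K) ^ m * c \<le> ?K * ?Q"
    using mult_mono[OF Suc c(2) P_nonneg c(1)] chain_step[OF s, of "int m"] by simp
  then have "c * (c / ?K) ^ m * c / ?K \<le> ?Q"
    using K by (simp add: pos_divide_le_eq mult.commute)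
  then show ?case by (simp add: algebra_simps)
qed (use c in simp)

end

section \<open>Arches at every scale, long crossings and the conclusion\<close>

lemma (in slab_perc) arch:
  assumes e: "1 \<le> e" and d: "d = int e" and c: "0 < c" "c \<le> X (54 * e) (72 * e)" "c \<le> X (72 * e) (96 * e)"
  defines "K \<equiv> 1 + 2 * glue_const k"
  shows "\<exists>s1 s2. - (54 * d) \<le> s1 \<and> s2 + d \<le> 54 * d \<and> 3 * d < s2 - s1 \<and>
    min ((c * (c / 96) / 2)\<^sup>2 / K) ((c / 96) * (c * (c / 96) / (2 * K)) / K)
      \<le> P (box k (- (54 * d)) (54 * d) 0 (72 * d)) (seg d s1) (seg d s2)"
proof -
  interpret half_box p k d by unfold_locales (use e d in simp)
  have K: "0 < K" using p_pos p_less_1 by (simp add: K_def glue_const_def add_pos_nonneg)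
  obtain i where i: "i \<in> {0..47}" and top0: "\<And>t. \<bar>t\<bar> \<le> 6 * d \<Longrightarrow> X (72 * e) (96 * e) / 96 \<le> P VB (seg d (t + i * d)) TT"
    using seg_to_top[OF e d] by auto
  have top: "c / 96 \<le> P VB (seg d (t + i * d)) TT" if "\<bar>t\<bar> \<le> 6 * d" for t
    using top0[OF that] c(3) by simp
  have id: "0 \<le> i * d" "i * d \<le> 47 * d" using i d_pos by auto
  \<comment> \<open>The offset \<open>2 * d\<close> puts the segment to the right of the middle line
    and makes the distance between the left ends of the segment and its mirror image,
    \<open>2 * s + d\<close>, at least \<open>5 * d\<close>.\<close>
  define s where "s = 2 * d + i * d"
  have side: "P VP JJ D0 = X (54 * e) (72 * e)"
    unfolding X_def using P_commute by (simp add: d)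
  have "c * (c / 96) \<le> P VP JJ D0 * P VB (seg d s) TT"
    unfolding side s_def using c d_pos by (intro mult_mono top) auto
  also have "\<dots> \<le> sqrt (K * P VB (seg d s) (refl_x 0 ` seg d s)) + K * P VB (seg d s) JJ"
    unfolding K_def using d_pos id by (intro mirror_or_side) (simp add: s_def)
  \<comment> \<open>One of the two summands is at least half of the lower bound.\<close>
  finally consider "c * (c / 96) / 2 \<le> sqrt (K * P VB (seg d s) (refl_x 0 ` seg d s))"
    | "c * (c / 96) / 2 \<le> K * P VB (seg d s) JJ" by linarith
  then show ?thesis
  proof cases
    case 1
    have "(c * (c / 96) / 2)\<^sup>2 \<le> (sqrt (K * P VB (seg d s) (refl_x 0 ` seg d s)))\<^sup>2"
      using 1 c by (intro power_mono) auto
    then have "(c * (c / 96) / 2)\<^sup>2 / K \<le> P VB (seg d s) (refl_x 0 ` seg d s)"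
      using K by (simp add: field_simps)
    also have "refl_x 0 ` seg d s = seg d (- s - d)" unfolding seg_def refl_x_box by simp
    finally have "(c * (c / 96) / 2)\<^sup>2 / K \<le> P VB (seg d (- s - d)) (seg d s)" by (simp add: P_commute)
    moreover have "- (54 * d) \<le> - s - d" "s + d \<le> 54 * d" "3 * d < s - (- s - d)"
      unfolding s_def using id d_pos by linarith+
    ultimately show ?thesis by (meson min.coboundedI1)
  next
    case 2
    \<comment> \<open>The offset \<open>6 * d\<close> is the largest that \<open>top\<close>
      permits. It gives \<open>s' - s = 4 * d\<close>, more than the required \<open>3 * d\<close>,
      and as \<open>i \<le> 47\<close> the segment ends no later than \<open>54 * d\<close>.\<close>
    define s' where "s' = 6 * d + i * d"
    have "c / 96 * (c * (c / 96) / (2 * K)) \<le> P VB (seg d s') TT * P VB (seg d s) JJ"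
      unfolding s'_def using 2 K c d_pos by (intro mult_mono top) (auto simp: field_simps)
    also have "\<dots> \<le> K * P VB (seg d s) (seg d s')"
      unfolding K_def using d_pos by (intro side_imp_shifted) (simp add: s_def s'_def)
    finally have "c / 96 * (c * (c / 96) / (2 * K)) / K \<le> P VB (seg d s) (seg d s')"
      using K by (simp add: field_simps)
    moreover have "- (54 * d) \<le> s" "s' + d \<le> 54 * d" "3 * d < s' - s"
      unfolding s_def s'_def using id d_pos by linarith+
    ultimately show ?thesis by (meson min.coboundedI2)
  qed
qed

lemma (in slab_perc) long_crossing:
  assumes c: "0 < c" "\<And>e. 1 \<le> e \<Longrightarrow> c \<le> X (6 * e) (8 * e)"
  shows "\<exists>c'>0. \<forall>e\<ge>1. c' \<le> X (288 * e) (72 * e)"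
proof -
  define K where "K = 1 + 2 * glue_const k"
  have K: "0 < K" using p_pos p_less_1 by (simp add: K_def glue_const_def add_pos_nonneg)
  define a where "a = min ((c * (c / 96) / 2)\<^sup>2 / K) ((c / 96) * (c * (c / 96) / (2 * K)) / K)"
  have a: "0 < a" using c(1) K by (simp add: a_def)
  have "a * (a / K) ^ 144 \<le> X (288 * e) (72 * e)" if e: "1 \<le> e" for e
  proof -
    define d where "d = int e"
    interpret half_box p k d by unfold_locales (use e d_def in simp)
    have "c \<le> X (54 * e) (72 * e)" "c \<le> X (72 * e) (96 * e)"
      using c(2)[of "9 * e"] c(2)[of "12 * e"] e by simp_all
    then obtain s1 s2 where s: "- (54 * d) \<le> s1" "s2 + d \<le> 54 * d" "3 * d < s2 - s1" "a \<le> P VB (seg d s1) (seg d s2)"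
      using arch[OF e d_def c(1)] unfolding a_def K_def by blast
    \<comment> \<open>144 translations by \<open>2 * d\<close> add a length of
      \<open>288 * d\<close>, four times the height.\<close>
    have "a * (a / K) ^ 144 \<le> P (box k (- (54 * d)) (54 * d + 2 * d * int 144) 0 (72 * d)) (seg d s1) (seg d (s2 + 2 * d * int 144))"
      unfolding K_def using a s by (intro chain) auto
    also have "\<dots> \<le> X (288 * e) (72 * e)"
      \<comment> \<open>The left segment ends at \<open>s1 + d\<close>, and the right one starts
        beyond \<open>s1 + d + 288 * d\<close> because \<open>s2 - s1\<close> exceeds
        \<open>3 * d\<close>.\<close>
      by (rule P_subcrossing[of _ _ "s1 + d" _ "s1 + d + 288 * d" "- (54 * d)" "54 * d + 2 * d * int 144"])
        (use s in \<open>auto simp: seg_def d_def box_def\<close>)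
    finally show ?thesis .
  qed
  moreover have "0 < a * (a / K) ^ 144" using a K by simp
  ultimately show ?thesis by blast
qed

theorem mainTheorem12:
  fixes k :: nat and \<epsilon> p :: real
  assumes "k \<ge> 1" and "\<epsilon> > 0" and "\<epsilon> \<le> p" and "p \<le> 1 - \<epsilon>"
    and "(INF n\<in>{1::nat..}. f k p n (2 * n)) > 0"
  shows "(INF n\<in>{1::nat..}. f k p (2 * n) n) > 0"
proof -
  interpret slab_perc p k by unfold_locales (use assms in auto)
  define c0 where "c0 = (INF n\<in>{1::nat..}. f k p n (2 * n))"
  have c0: "0 < c0" using assms(5) by (simp add: c0_def)
  have low: "c0 \<le> X n (2 * n)" if "1 \<le> n" for n
    unfolding c0_def f_eq_X[symmetric] using that
    by (intro cINF_lower bdd_belowI2[of _ 0]) (auto simp: f_def)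
  have "c0 / 26 \<le> X (6 * e) (8 * e)" if "1 \<le> e" for e
    using low[of "6 * e"] X_near_square[OF that] that by simp
  then obtain c where c: "0 < c" "\<And>e. 1 \<le> e \<Longrightarrow> c \<le> X (288 * e) (72 * e)"
    using long_crossing[of "c0 / 26"] c0 by auto
  \<comment> \<open>The finitely many values \<open>n \<le> 72\<close> have positive crossing
    probabilities by \<open>X_pos\<close>; larger ones are compared with a multiple of 72.\<close>
  define c' where "c' = min c (Min ((\<lambda>n. X (2 * n) n) ` {1..72}))"
  have "0 < c'" unfolding c'_def using c(1) X_pos by simp
  also have "c' \<le> (INF n\<in>{1::nat..}. f k p (2 * n) n)"
  proof (rule cINF_greatest)
    fix n :: nat assume n: "n \<in> {1..}"
    show "c' \<le> f k p (2 * n) n"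
    proof (cases "n \<le> 72")
      case True
      then show ?thesis using n unfolding c'_def f_eq_X by (intro min.coboundedI2 Min_le) auto
    next
      case False
      \<comment> \<open>From \<open>1 \<le> e\<close> follows
        \<open>n < 72 * (e + 1) \<le> 144 * e\<close>, so a crossing of length
        \<open>288 * e\<close> is long enough for \<open>2 * n\<close>.\<close>
      define e where "e = n div 72"
      have "72 * e + n mod 72 = n" "n mod 72 < 72" by (simp_all add: e_def)
      moreover from this have "1 \<le> e" using False by linarith
      ultimately have e: "1 \<le> e" "72 * e \<le> n" "2 * n \<le> 288 * e" by linarith+
      have "c' \<le> X (288 * e) (72 * e)" using c(2)[OF e(1)] by (simp add: c'_def)
      also have "\<dots> \<le> X (288 * e) n" by (rule X_mono[OF e(2)])
      also have "\<dots> \<le> X (2 * n) n" by (rule X_antimono[OF e(3)])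
      finally show ?thesis by (simp add: f_eq_X)
    qed
  qed simp
  finally show ?thesis .
qed

end
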